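(* Let $n$ be a prime and let $X_n$ be the $2$-dimensional simplicial complex on vertex set $\mathbb{Z}_n$ with full $1$-skeleton whose $2$-faces are exactly the $3$-term arithmetic progressions $\{a,a+d,a+2d\}$ in $\mathbb{Z}_n$ with difference $d\notin\{0,\pm1\}$. Let $G_n=\mathbb{Z}_n^*/\{\pm1\}$ and let $H_n$ be the subgroup of $G_n$ generated by (the class of) $2$. Then $\mathrm{rank}_{\mathbb{Q}}(X_n)=|X_n|-(n-1)\cdot([G_n:H_n]-1)$, where $|X_n|$ is the number of $2$-faces. In particular, $X_n$ is acyclic over $\mathbb{Q}$ if and only if $\mathbb{Z}_n^*$ is generated by $\{\pm1,2\}$.
   Context: $\mathrm{rank}_{\mathbb{Q}}(X_n)$ is the rank over $\mathbb{Q}$ of the set of columns of the $2$-dimensional boundary matrix $\partial_2$ (with $\partial(v_0,v_1,v_2)=(v_1,v_2)-(v_0,v_2)+(v_0,v_1)$, arbitrary fixed orientations) corresponding to the $2$-faces of $X_n$. A set of faces is acyclic if its rank equals its cardinality. *)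

theory Defs
  imports
    "HOL-Number_Theory.Residues"
    "HOL-Algebra.Generated_Groups"
    "HOL-Library.Function_Algebras"
begin

section \<open>Rational chains and the boundary matrix\<close>

interpretation rat_fun: vector_space "\<lambda>(c::rat) (f::'i \<Rightarrow> rat) i. c * f i"
  by unfold_locales (auto simp: algebra_simps)

text \<open>An orientation of the edges (triangles) of a vertex set chooses an ordering of the
  vertices of every 2-subset (3-subset).\<close>

definition edge_orientation :: "'v set \<Rightarrow> ('v set \<Rightarrow> 'v \<times> 'v) \<Rightarrow> bool" where
  "edge_orientation V oE \<longleftrightarrow>
     (\<forall>e. e \<subseteq> V \<and> card e = 2 \<longrightarrow> (case oE e of (u, v) \<Rightarrow> e = {u, v}))"

definition triangle_orientation :: "'v set \<Rightarrow> ('v set \<Rightarrow> 'v \<times> 'v \<times> 'v) \<Rightarrow> bool" where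
  "triangle_orientation V oT \<longleftrightarrow>
     (\<forall>t. t \<subseteq> V \<and> card t = 3 \<longrightarrow> (case oT t of (u, v, w) \<Rightarrow> t = {u, v, w}))"

text \<open>The ordered edge \<open>(u, v)\<close> as a rational chain: a vector indexed by the edges, with entry 1
  or -1 at \<open>{u, v}\<close> according to whether \<open>(u, v)\<close> agrees with the chosen orientation.\<close>

definition edge_chain :: "('v set \<Rightarrow> 'v \<times> 'v) \<Rightarrow> 'v \<times> 'v \<Rightarrow> 'v set \<Rightarrow> rat" where
  "edge_chain oE p = (\<lambda>e. if e = {fst p, snd p} then (if oE e = p then 1 else - 1) else 0)"

fun boundary :: "('v set \<Rightarrow> 'v \<times> 'v) \<Rightarrow> 'v \<times> 'v \<times> 'v \<Rightarrow> 'v set \<Rightarrow> rat" where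
  "boundary oE (v0, v1, v2) =
     edge_chain oE (v1, v2) - edge_chain oE (v0, v2) + edge_chain oE (v0, v1)"

definition boundary_column ::
  "('v set \<Rightarrow> 'v \<times> 'v) \<Rightarrow> ('v set \<Rightarrow> 'v \<times> 'v \<times> 'v) \<Rightarrow> 'v set \<Rightarrow> 'v set \<Rightarrow> rat" where
  "boundary_column oE oT t = boundary oE (oT t)"

definition rank_rat ::
  "('v set \<Rightarrow> 'v \<times> 'v) \<Rightarrow> ('v set \<Rightarrow> 'v \<times> 'v \<times> 'v) \<Rightarrow> 'v set set \<Rightarrow> nat" where
  "rank_rat oE oT F = rat_fun.dim (boundary_column oE oT ` F)"

definition acyclic_rat ::
  "('v set \<Rightarrow> 'v \<times> 'v) \<Rightarrow> ('v set \<Rightarrow> 'v \<times> 'v \<times> 'v) \<Rightarrow> 'v set set \<Rightarrow> bool" where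
  "acyclic_rat oE oT F \<longleftrightarrow> rank_rat oE oT F = card F"

section \<open>The complex of arithmetic progressions\<close>

abbreviation Zmod :: "nat \<Rightarrow> int ring" where
  "Zmod n \<equiv> residue_ring (int n)"

definition ap_triples :: "nat \<Rightarrow> int set set" where
  "ap_triples n =
     {{a, a \<oplus>\<^bsub>Zmod n\<^esub> d, a \<oplus>\<^bsub>Zmod n\<^esub> d \<oplus>\<^bsub>Zmod n\<^esub> d} | a d.
        a \<in> carrier (Zmod n) \<and> d \<in> carrier (Zmod n) \<and>
        d \<notin> {\<zero>\<^bsub>Zmod n\<^esub>, \<one>\<^bsub>Zmod n\<^esub>, \<ominus>\<^bsub>Zmod n\<^esub> \<one>\<^bsub>Zmod n\<^esub>}}"

definition ap_complex :: "nat \<Rightarrow> int set set" where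
  "ap_complex n = {s. s \<subseteq> carrier (Zmod n) \<and> card s \<le> 2} \<union> ap_triples n"

definition two_faces :: "'v set set \<Rightarrow> 'v set set" where
  "two_faces K = {s \<in> K. card s = 3}"

section \<open>The groups\<close>

abbreviation Zmod_units :: "nat \<Rightarrow> int monoid" where
  "Zmod_units n \<equiv> units_of (Zmod n)"

definition pm_one :: "nat \<Rightarrow> int set" where
  "pm_one n = {\<one>\<^bsub>Zmod n\<^esub>, \<ominus>\<^bsub>Zmod n\<^esub> \<one>\<^bsub>Zmod n\<^esub>}"

definition two_res :: "nat \<Rightarrow> int" where
  "two_res n = \<one>\<^bsub>Zmod n\<^esub> \<oplus>\<^bsub>Zmod n\<^esub> \<one>\<^bsub>Zmod n\<^esub>"

definition G_grp :: "nat \<Rightarrow> int set monoid" where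
  "G_grp n = Zmod_units n Mod pm_one n"

text \<open>\<^const>\<open>subgroup_generated\<close> discards generators outside the group. This matters only for
  \<open>n = 2\<close>, where 2 is not a unit and the subgroup is the trivial one.\<close>

definition H_grp :: "nat \<Rightarrow> int set set" where
  "H_grp n = carrier (subgroup_generated (G_grp n) {pm_one n #>\<^bsub>Zmod_units n\<^esub> two_res n})"

definition group_index :: "('a, 'b) monoid_scheme \<Rightarrow> 'a set \<Rightarrow> nat" where
  "group_index G H = card (rcosets\<^bsub>G\<^esub> H)"

end

theory Submission
  imports Defs
begin

text \<open>Write \<open>C d m\<close> for the coefficient of the oriented face \<open>(m - d, m, m + d)\<close>, so that
  \<open>C (- d) = - C d\<close>. A chain supported on progressions is a cycle iff
  \<open>C d m = C (2 * d) (m - d) + C (2 * d) (m + d)\<close> for all \<open>d\<close> and \<open>m\<close>. For a cycle, the difference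
  \<open>f m = C d (m + d) - C d (m - d)\<close> is unchanged when \<open>d\<close> is replaced by \<open>- d\<close> or \<open>2 * d\<close>, and
  \<open>C d\<close> has sum zero, because its sum \<open>s\<close> satisfies \<open>s = 2 ^ (n - 1) * s\<close>. Hence a cycle is given by
  one function \<open>f\<close> of sum zero on each coset of the group generated by \<open>-1\<close> and \<open>2\<close>, and every choice of
  such functions occurs, except that \<open>f\<close> vanishes on the coset of \<open>1\<close>, as \<open>d = 1\<close> is not allowed.
  Concretely, deleting the faces with \<open>d\<close> a fixed representative of a coset other than that of \<open>1\<close>
  and \<open>m \<noteq> 0\<close> leaves a basis of the column space.\<close>

text \<open>Independence is asked of the family indexed by \<open>S\<close>, not of its image set,
  so injectivity of \<open>v\<close> on \<open>S\<close> comes with it: \<open>v i = v j\<close>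
  would be a nontrivial relation. The dimension can then be read off as a number of indices.\<close>

lemma (in vector_space) dim_image_eq_card:
  assumes "finite S" "S \<subseteq> I"
    and indep: "\<And>c. (\<Sum>i\<in>S. c i *s v i) = 0 \<Longrightarrow> \<forall>i\<in>S. c i = 0"
    and spanning: "\<And>i. i \<in> I - S \<Longrightarrow> v i \<in> span (v ` S)"
  shows "dim (v ` I) = card S"
proof -
  have inj: "inj_on v S"
  proof (rule inj_onI, rule ccontr)
    fix i j assume ij: "i \<in> S" "j \<in> S" "v i = v j" "i \<noteq> j"
    define c where "c k = (if k = i then 1 else if k = j then -1 else 0 :: 'a)" for k
    have "(\<Sum>k\<in>S. c k *s v k) = (\<Sum>k\<in>{i, j}. c k *s v k)"
      using ij assms(1) by (intro sum.mono_neutral_right) (auto simp: c_def)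
    also have "\<dots> = 0"
      using ij by (simp add: c_def)
    finally have "c i = 0" using indep ij by blast
    then show False by (simp add: c_def)
  qed
  have "independent (v ` S)"
  proof
    assume "dependent (v ` S)"
    then obtain u where u: "\<exists>x\<in>v ` S. u x \<noteq> 0" "(\<Sum>x\<in>v ` S. u x *s x) = 0"
      using dependent_finite[of "v ` S"] assms(1) by auto
    from u(2) have "(\<Sum>i\<in>S. u (v i) *s v i) = 0"
      by (simp add: sum.reindex[OF inj])
    with indep[of "\<lambda>i. u (v i)"] u(1) show False by auto
  qed
  moreover have "span (v ` S) = span (v ` I)"
  proof (rule span_eq[THEN iffD2], intro conjI subsetI)
    fix x assume "x \<in> v ` S"
    then show "x \<in> span (v ` I)" using assms(2) by (auto intro: span_base)
  next
    fix x assume "x \<in> v ` I"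
    then show "x \<in> span (v ` S)" using spanning by (auto intro: span_base)
  qed
  ultimately have "dim (v ` I) = card (v ` S)" by (rule dim_eq_card[rotated])
  with inj show ?thesis by (simp add: card_image)
qed

section \<open>Difference equations on periodic functions\<close>

locale odd_prime_modulus =
  fixes N :: int
  assumes prime: "prime N" and odd: "odd N"
begin

text \<open>Functions on the integers modulo \<open>N\<close> are encoded as functions on all
  integers, so that shifts and multiples of the argument need no reduction.\<close>

definition periodic :: "(int \<Rightarrow> 'a) \<Rightarrow> bool" where
  "periodic p \<longleftrightarrow> (\<forall>x. p (x mod N) = p x)"

lemma gt2: "N > 2"
  using prime_ge_2_int[OF prime] odd by (cases "N = 2") auto

lemma periodic_cong: "periodic p \<Longrightarrow> [x = y] (mod N) \<Longrightarrow> p x = p y"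
  by (metis periodic_def cong_def)

lemma periodic_shift:
  assumes "periodic p" shows "periodic (\<lambda>x. p (x + a))"
  unfolding periodic_def
  by (auto intro!: periodic_cong[OF assms] simp: cong_def mod_simps)

lemma sum_shift:
  fixes p :: "int \<Rightarrow> 'a::comm_monoid_add"
  assumes "periodic p"
  shows "(\<Sum>m\<in>{0..<N}. p (m + a)) = (\<Sum>m\<in>{0..<N}. p m)"
proof (rule sum.reindex_bij_witness[where i = "\<lambda>m. (m - a) mod N" and j = "\<lambda>m. (m + a) mod N"])
  show "p ((m + a) mod N) = p (m + a)" for m
    using assms by (simp add: periodic_def)
qed (use gt2 in \<open>auto simp: mod_simps\<close>)

text \<open>Multiplication by the unit \<open>a\<close> permutes the nonzero residues, and
  multiplication by \<open>b\<close> undoes it.\<close>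

lemma sum_mult_unit:
  fixes p :: "int \<Rightarrow> 'a::comm_monoid_add"
  assumes "periodic p" "[a * b = 1] (mod N)"
  shows "(\<Sum>d\<in>{1..<N}. p (a * d)) = (\<Sum>d\<in>{1..<N}. p d)"
proof (rule sum.reindex_bij_witness[where i = "\<lambda>d. (b * d) mod N" and j = "\<lambda>d. (a * d) mod N"])
  have range: "(u * d) mod N \<in> {1..<N}" if "[u * w = 1] (mod N)" "d \<in> {1..<N}" for u w d :: int
  proof -
    have "coprime u N" using that(1) coprime_iff_invertible_int by blast
    then have "\<not> N dvd u" using gt2 by auto
    moreover have "\<not> N dvd d" using that(2) zdvd_not_zless by auto
    ultimately have "\<not> N dvd u * d" using prime prime_dvd_mult_iff by blast
    then have "(u * d) mod N \<noteq> 0" by auto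
    moreover have "(u * d) mod N \<ge> 0" "(u * d) mod N < N" using gt2 by auto
    ultimately show ?thesis by simp
  qed
  have ba: "[b * a = 1] (mod N)" using assms(2) by (simp add: mult.commute)
  have cancel: "(u * (w * d mod N)) mod N = d" if "[u * w = 1] (mod N)" "d \<in> {1..<N}" for u w d :: int
  proof -
    have "[u * w * d = 1 * d] (mod N)" using that(1) by (rule cong_scalar_right)
    then show ?thesis using that(2) by (simp add: cong_def mod_simps mult.assoc)
  qed
  fix d assume d: "d \<in> {1..<N}"
  show "(a * d) mod N \<in> {1..<N}" using range[OF assms(2) d] .
  show "(b * d) mod N \<in> {1..<N}" using range[OF ba d] .
  show "b * (a * d mod N) mod N = d" using cancel[OF ba d] .
  show "a * (b * d mod N) mod N = d" using cancel[OF assms(2) d] .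
  show "p ((a * d) mod N) = p (a * d)"
    using assms(1) by (simp add: periodic_def)
qed

text \<open>This integer plays two roles: it is the inverse of 2 modulo \<open>N\<close>, and
  \<open>{1..<half}\<close> contains exactly one of \<open>d\<close> and \<open>- d\<close> for each
  nonzero residue \<open>d\<close>.\<close>

definition half :: int where "half = (N + 1) div 2"

lemma two_half: "2 * half = N + 1"
  using odd by (auto simp: half_def elim: oddE)

lemma two_half_cong: "[2 * half = 1] (mod N)"
  by (simp add: two_half cong_def)

lemma unit_inverse:
  assumes "\<not> N dvd d"
  obtains e where "[d * e = 1] (mod N)"
proof -
  have "coprime d N" using prime_imp_coprime[OF prime assms] by (simp add: coprime_commute)
  then show ?thesis using that by (auto simp: coprime_iff_invertible_int)
qed

lemma fermat: "[2 ^ (nat N - 1) = 1] (mod N)"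
proof -
  have "prime (nat N)" using prime prime_int_nat_transfer by blast
  moreover have "\<not> nat N dvd 2"
    using gt2 dvd_imp_le[of "nat N" 2] by linarith
  ultimately have "[2 ^ (nat N - 1) = 1] (mod nat N)" by (rule fermat_theorem)
  then have "[int (2 ^ (nat N - 1)) = int 1] (mod int (nat N))" by (simp only: cong_int_iff)
  then show ?thesis using gt2 by (simp only: of_nat_power of_nat_numeral of_nat_1 int_nat_eq) simp
qed

text \<open>The hypothesis is invariance under translation by \<open>2 * d\<close>. As
  \<open>2 * d\<close> is a unit, its multiples reach every residue.\<close>

lemma periodic_step_const:
  assumes p: "periodic p" and d: "\<not> N dvd d" and step: "\<And>m. p (m + d) = p (m - d)"
  shows "p x = p y"
proof -
  have step2: "p (x + int k * (2 * d)) = p x" for k x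
  proof (induction k)
    case (Suc k)
    have "p (x + int (Suc k) * (2 * d)) = p ((x + int k * (2 * d) + d) + d)"
      by (simp add: algebra_simps)
    also have "\<dots> = p (x + int k * (2 * d))" by (subst step) simp
    finally show ?case using Suc by simp
  qed simp
  have "\<not> N dvd 2 * d"
    using d prime_dvd_mult_iff[OF prime, of 2 d] gt2 by (auto dest: zdvd_imp_le)
  then obtain e where e: "[2 * d * e = 1] (mod N)" using unit_inverse by blast
  \<comment> \<open>The number of steps of length \<open>2 * d\<close> that lead from
    \<open>y\<close> to \<open>x\<close> modulo \<open>N\<close>.\<close>
  define k where "k = nat ((e * (x - y)) mod N)"
  have k: "int k = (e * (x - y)) mod N" using gt2 by (simp add: k_def)
  have "[int k * (2 * d) = e * (x - y) * (2 * d)] (mod N)"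
    by (simp add: k cong_def mod_simps)
  also have "e * (x - y) * (2 * d) = 2 * d * e * (x - y)" by (simp add: algebra_simps)
  also have "[2 * d * e * (x - y) = 1 * (x - y)] (mod N)" using e by (rule cong_scalar_right)
  finally have "[y + int k * (2 * d) = y + (x - y)] (mod N)" by (intro cong_add) auto
  then have "p (y + int k * (2 * d)) = p x" by (intro periodic_cong[OF p]) simp
  then show ?thesis using step2 by simp
qed

text \<open>The difference operator kills only constants, and the sum over a period detects a
  constant because \<open>N\<close> is nonzero in the rationals. All later identities between
  solutions of a difference equation come from this.\<close>

lemma periodic_diff_unique:
  fixes p q :: "int \<Rightarrow> rat"
  assumes p: "periodic p" and q: "periodic q" and d: "\<not> N dvd d"
    and step: "\<And>m. p (m + d) - p (m - d) = q (m + d) - q (m - d)"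
    and sum: "(\<Sum>m\<in>{0..<N}. p m) = (\<Sum>m\<in>{0..<N}. q m)"
  shows "p x = q x"
proof -
  define r where "r m = p m - q m" for m
  have r: "periodic r" using p q by (simp add: periodic_def r_def)
  have "r (m + d) = r (m - d)" for m using step[of m] by (simp add: r_def)
  then have const: "r y = r x" for y using periodic_step_const[OF r d] by blast
  have "0 = (\<Sum>m\<in>{0..<N}. r m)" using sum by (simp add: r_def sum_subtractf)
  also have "\<dots> = (\<Sum>m\<in>{0..<N}. r x)" using const by (intro sum.cong) auto
  also have "\<dots> = of_int N * r x" using gt2 by simp
  finally show ?thesis using gt2 by (simp add: r_def)
qed

text \<open>With \<open>\<tau>\<close> the shift by \<open>2 * d\<close>, the operator \<open>(\<tau> - 1) * (\<Sum>k<N. k * \<tau>^k)\<close> equals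
  \<open>N - (\<Sum>k<N. \<tau>^k)\<close>, hence is multiplication by \<open>N\<close> on functions of sum zero.\<close>

definition antidiff :: "(int \<Rightarrow> rat) \<Rightarrow> int \<Rightarrow> int \<Rightarrow> rat" where
  "antidiff f d m = (\<Sum>k<nat N. of_nat k * f (m + d + 2 * d * int k)) / of_int N"

lemma antidiff_periodic:
  assumes f: "periodic f"
  shows "periodic (antidiff f d)"
  unfolding periodic_def antidiff_def
  by (intro allI arg_cong2[where f = "(/)"] refl sum.cong arg_cong2[where f = "(*)"] periodic_cong[OF f]
      cong_add cong_refl) (simp add: cong_def)

lemma antidiff_cong:
  assumes f: "periodic f" and "[d = d'] (mod N)"
  shows "antidiff f d m = antidiff f d' m"
  unfolding antidiff_def
  by (intro arg_cong2[where f = "(/)"] refl sum.cong arg_cong2[where f = "(*)"] periodic_cong[OF f]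
      cong_add cong_mult assms cong_refl)

lemma sum_antidiff:
  assumes f: "periodic f" and sum: "(\<Sum>m\<in>{0..<N}. f m) = 0"
  shows "(\<Sum>m\<in>{0..<N}. antidiff f d m) = 0"
proof -
  have "(\<Sum>m\<in>{0..<N}. antidiff f d m) =
      (\<Sum>m\<in>{0..<N}. \<Sum>k<nat N. of_nat k * f (m + (d + 2 * d * int k))) / of_int N"
    by (simp add: antidiff_def sum_divide_distrib add.assoc)
  also have "(\<Sum>m\<in>{0..<N}. \<Sum>k<nat N. of_nat k * f (m + (d + 2 * d * int k))) =
      (\<Sum>k<nat N. of_nat k * (\<Sum>m\<in>{0..<N}. f (m + (d + 2 * d * int k))))"
    by (subst sum.swap) (simp add: sum_distrib_left)
  also have "\<dots> = 0" by (simp only: sum_shift[OF f] sum) simp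
  finally show ?thesis by simp
qed

text \<open>Since \<open>2 * d\<close> is a unit, the progression visits every residue exactly
  once.\<close>

lemma sum_progression:
  fixes f :: "int \<Rightarrow> rat"
  assumes f: "periodic f" and d: "\<not> N dvd d"
  shows "(\<Sum>k<nat N. f (m + 2 * d * int k)) = (\<Sum>x\<in>{0..<N}. f x)"
proof -
  have d2: "\<not> N dvd 2 * d"
    using d prime_dvd_mult_iff[OF prime, of 2 d] gt2 by (auto dest: zdvd_imp_le)
  then obtain e where e: "[2 * d * e = 1] (mod N)" using unit_inverse by blast
  have g: "periodic (\<lambda>x. f (x + m))" using f by (rule periodic_shift)
  have "(\<Sum>k<nat N. f (m + 2 * d * int k)) = (\<Sum>k\<in>{0..<N}. f (m + 2 * d * k))"
    using gt2 by (intro sum.reindex_bij_witness[where i = nat and j = int]) auto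
  \<comment> \<open>The term at 0 is split off because \<open>sum_mult_unit\<close> permutes the
    nonzero residues only.\<close>
  also have "\<dots> = f m + (\<Sum>k\<in>{1..<N}. f (m + 2 * d * k))"
  proof -
    have "{0..<N} = insert 0 {1..<N}" using gt2 by auto
    then show ?thesis by simp
  qed
  also have "(\<Sum>k\<in>{1..<N}. f (m + 2 * d * k)) = (\<Sum>k\<in>{1..<N}. f (k + m))"
    using sum_mult_unit[OF g e] by (simp add: add.commute)
  also have "f m + \<dots> = (\<Sum>k\<in>{0..<N}. f (k + m))"
  proof -
    have "{0..<N} = insert 0 {1..<N}" using gt2 by auto
    then show ?thesis by simp
  qed
  also have "\<dots> = (\<Sum>x\<in>{0..<N}. f x)" using f by (rule sum_shift)
  finally show ?thesis .
qed

lemma antidiff_step: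
  assumes f: "periodic f" and sum: "(\<Sum>m\<in>{0..<N}. f m) = 0" and d: "\<not> N dvd d"
  shows "antidiff f d (m + d) - antidiff f d (m - d) = f m"
proof -
  define g where "g k = f (m + 2 * d * int k)" for k
  \<comment> \<open>Summation by parts. At \<open>M = nat N\<close> the last sum runs over a full
    period and vanishes, so only the end term \<open>N * g N\<close> survives.\<close>
  have telescope: "(\<Sum>k<M. of_nat k * g (Suc k)) - (\<Sum>k<M. of_nat k * g k) =
      of_nat M * g M - (\<Sum>k<M. g (Suc k))" for M
    by (induction M) (simp_all add: algebra_simps)
  have "(\<Sum>k<nat N. g (Suc k)) = (\<Sum>k<nat N. f (m + 2 * d + 2 * d * int k))"
    by (simp add: g_def algebra_simps)
  then have sum0: "(\<Sum>k<nat N. g (Suc k)) = 0" using sum_progression[OF f d] sum by simp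
  \<comment> \<open>After \<open>N\<close> steps of length \<open>2 * d\<close> the argument is back
    at \<open>m\<close> modulo \<open>N\<close>.\<close>
  have gN: "g (nat N) = f m"
    unfolding g_def using gt2 by (intro periodic_cong[OF f]) (simp add: cong_def)
  have "antidiff f d (m + d) - antidiff f d (m - d) =
      ((\<Sum>k<nat N. of_nat k * g (Suc k)) - (\<Sum>k<nat N. of_nat k * g k)) / of_int N"
    by (simp add: antidiff_def g_def diff_divide_distrib algebra_simps)
  also have "\<dots> = f m"
    using gt2 by (simp add: telescope sum0 gN)
  finally show ?thesis .
qed

end

section \<open>The cycle equation\<close>

context odd_prime_modulus
begin

lemma not_dvd_iff: "\<not> N dvd x \<longleftrightarrow> x mod N \<in> {1..<N}"
  using gt2 pos_mod_sign[of N x] pos_mod_bound[of N x] unfolding dvd_eq_mod_eq_0 atLeastLessThan_iff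
  by linarith

lemma not_dvd_mult: "\<not> N dvd a \<Longrightarrow> \<not> N dvd b \<Longrightarrow> \<not> N dvd a * b"
  using prime prime_dvd_mult_iff by blast

lemma not_dvd_two: "\<not> N dvd 2"
  using gt2 by (auto dest: zdvd_imp_le)

text \<open>The reflection taking \<open>d\<close> to \<open>N - d\<close> exchanges
  \<open>{1..<half}\<close> and \<open>{half..<N}\<close>.\<close>

lemma sum_fold_sign:
  fixes f :: "int \<Rightarrow> rat"
  assumes f: "periodic f" and even: "\<And>d. d \<in> {1..<N} \<Longrightarrow> f (- d) = f d"
  shows "(\<Sum>d\<in>{1..<N}. f d) = 2 * (\<Sum>d\<in>{1..<half}. f d)"
proof -
  have "{1..<N} = {1..<half} \<union> {half..<N}" "{1..<half} \<inter> {half..<N} = {}"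
    using two_half gt2 by auto
  then have "(\<Sum>d\<in>{1..<N}. f d) = (\<Sum>d\<in>{1..<half}. f d) + (\<Sum>d\<in>{half..<N}. f d)"
    by (simp add: sum.union_disjoint)
  also have "(\<Sum>d\<in>{half..<N}. f d) = (\<Sum>d\<in>{1..<half}. f d)"
  proof (rule sum.reindex_bij_witness[where i = "\<lambda>d. N - d" and j = "\<lambda>d. N - d"])
    fix d assume d: "d \<in> {half..<N}"
    have "f (N - d) = f (- d)" by (intro periodic_cong[OF f]) (simp add: cong_def mod_simps)
    also have "\<dots> = f d" using d two_half gt2 by (intro even) auto
    finally show "f (N - d) = f d" .
  qed (use two_half in auto)
  finally show ?thesis by simp
qed

text \<open>A weight \<open>C d m\<close> is the coefficient of the oriented triangle \<open>(m - d, m, m + d)\<close>, read modulo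
  \<open>N\<close>; replacing \<open>d\<close> by \<open>-d\<close> reverses the orientation.\<close>

definition ap_weight :: "(int \<Rightarrow> int \<Rightarrow> rat) \<Rightarrow> bool" where
  "ap_weight C \<longleftrightarrow> (\<forall>d m. C (d mod N) (m mod N) = C d m) \<and> (\<forall>d m. C (- d) m = - C d m)"

definition ap_cycle :: "(int \<Rightarrow> int \<Rightarrow> rat) \<Rightarrow> bool" where
  "ap_cycle C \<longleftrightarrow> (\<forall>d m. C d m = C (2 * d) (m - d) + C (2 * d) (m + d))"

lemma ap_weight_cong:
  assumes "ap_weight C" "[d = d'] (mod N)" "[m = m'] (mod N)"
  shows "C d m = C d' m'"
proof -
  have "C d m = C (d mod N) (m mod N)" "C d' m' = C (d' mod N) (m' mod N)"
    using assms(1) by (simp_all add: ap_weight_def)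
  then show ?thesis using assms(2,3) by (simp add: cong_def)
qed

lemma ap_weight_periodic:
  assumes "ap_weight C"
  shows "periodic (C d)" "periodic (\<lambda>d. C d m)"
  using ap_weight_cong[OF assms, of d d "m mod N" m for m] ap_weight_cong[OF assms, of "d mod N" d m m for d]
  by (simp_all add: periodic_def cong_def)

lemma ap_weight_minus: "ap_weight C \<Longrightarrow> C (- d) m = - C d m"
  by (simp add: ap_weight_def)

end

section \<open>The boundary of a weighted sum of progressions\<close>

locale ap_boundary = odd_prime_modulus +
  fixes oE :: "int set \<Rightarrow> int \<times> int"
  assumes orientation: "edge_orientation {0..<N} oE"
begin

definition edge :: "int \<Rightarrow> int \<Rightarrow> int set \<Rightarrow> rat" where
  "edge x y = edge_chain oE (x mod N, y mod N)"

definition ap_bd :: "int \<Rightarrow> int \<Rightarrow> int set \<Rightarrow> rat" where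
  "ap_bd d m = boundary oE ((m - d) mod N, m mod N, (m + d) mod N)"

lemma ap_bd_eq: "ap_bd d m e = edge m (m + d) e - edge (m - d) (m + d) e + edge (m - d) m e"
  by (simp add: ap_bd_def edge_def)

lemma edge_cong:
  "[x = x'] (mod N) \<Longrightarrow> [y = y'] (mod N) \<Longrightarrow> edge x y = edge x' y'"
  by (simp add: edge_def cong_def)

lemma edge_orient_cases:
  assumes "\<not> [x = y] (mod N)"
  shows "oE {x mod N, y mod N} \<in> {(x mod N, y mod N), (y mod N, x mod N)}"
proof -
  obtain u v where uv: "oE {x mod N, y mod N} = (u, v)" by fastforce
  have "{x mod N, y mod N} \<subseteq> {0..<N}" using gt2 by auto
  moreover have "card {x mod N, y mod N} = 2" using assms by (simp add: cong_def)
  ultimately have "{x mod N, y mod N} = {u, v}"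
    using orientation[unfolded edge_orientation_def, rule_format, of "{x mod N, y mod N}"] uv by simp
  then show ?thesis using uv by (auto simp: doubleton_eq_iff)
qed

lemma edge_swap:
  assumes "\<not> [x = y] (mod N)"
  shows "edge y x e = - edge x y e"
proof -
  have "{y mod N, x mod N} = {x mod N, y mod N}" by blast
  then show ?thesis
    using edge_orient_cases[OF assms] assms by (auto simp: edge_def edge_chain_def cong_def)
qed

lemma edge_nonzero_iff:
  "edge x y e \<noteq> 0 \<longleftrightarrow> e = {x mod N, y mod N}"
  by (auto simp: edge_def edge_chain_def)

text \<open>Reversing the progression reverses each of its edges. Their differences are
  \<open>d\<close>, \<open>d\<close> and \<open>2 * d\<close>, all nonzero modulo the odd prime
  \<open>N\<close>, so every edge chain changes sign.\<close>

lemma ap_bd_minus: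
  assumes "\<not> N dvd d"
  shows "ap_bd (- d) m e = - ap_bd d m e"
proof -
  have "\<not> [m - d = m + d] (mod N)"
    using not_dvd_mult[OF not_dvd_two assms] by (simp add: cong_iff_dvd_diff)
  moreover have "\<not> [m = m + d] (mod N)" "\<not> [m - d = m] (mod N)"
    using assms by (simp_all add: cong_iff_dvd_diff)
  ultimately show ?thesis
    using edge_swap[of "m - d" "m + d" e] edge_swap[of m "m + d" e] edge_swap[of "m - d" m e]
    by (simp add: ap_bd_eq)
qed

lemma ap_bd_cong: "[d = d'] (mod N) \<Longrightarrow> [m = m'] (mod N) \<Longrightarrow> ap_bd d m = ap_bd d' m'"
  using cong_diff[of m m' N d d'] cong_add[of m m' N d d'] by (simp add: ap_bd_def cong_def)

text \<open>The ordered edge \<open>(m, m + d)\<close> is the second step of the progression centred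
  at \<open>m\<close>, the first step of the one centred at \<open>m + d\<close>, and the outer
  edge, with sign -1, of the one with difference \<open>half * d\<close> centred at the
  midpoint.\<close>

definition edge_coeff :: "(int \<Rightarrow> int \<Rightarrow> rat) \<Rightarrow> int \<Rightarrow> int \<Rightarrow> rat" where
  "edge_coeff C d m = C d m + C d (m + d) - C (half * d) (m + half * d)"

lemma sum_ap_bd:
  assumes C: "ap_weight C"
  shows "(\<Sum>d\<in>{1..<N}. \<Sum>m\<in>{0..<N}. C d m * ap_bd d m e) =
         (\<Sum>d\<in>{1..<N}. \<Sum>m\<in>{0..<N}. edge_coeff C d m * edge m (m + d) e)"
proof -
  \<comment> \<open>The contribution of the outer edges, to be subtracted. Recentring makes each of
    them start at \<open>m\<close>.\<close>
  define \<phi> where "\<phi> d = (\<Sum>m\<in>{0..<N}. C d m * edge (m - d) (m + d) e)" for d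
  have \<phi>: "\<phi> d = (\<Sum>m\<in>{0..<N}. C d (m + d) * edge m (m + 2 * d) e)" for d
  proof -
    have "periodic (\<lambda>m. C d m * edge (m - d) (m + d) e)"
      unfolding periodic_def
      by (intro allI arg_cong2[where f = "(*)"] ap_weight_cong[OF C] fun_cong[OF edge_cong]
          cong_add cong_diff cong_refl) (simp_all add: cong_def)
    from sum_shift[OF this, of d] show ?thesis by (simp add: \<phi>_def algebra_simps)
  qed
  have "periodic \<phi>"
    unfolding periodic_def \<phi>_def
    by (intro allI sum.cong refl arg_cong2[where f = "(*)"] ap_weight_cong[OF C] fun_cong[OF edge_cong]
          cong_add cong_diff cong_refl) (simp_all add: cong_def)
  \<comment> \<open>Substituting \<open>half * d\<close> for \<open>d\<close> turns the outer edge
    \<open>(m, m + 2 * d)\<close> into \<open>(m, m + d)\<close>, so that it can be collected with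
    the other two terms.\<close>
  then have "(\<Sum>d\<in>{1..<N}. \<phi> d) = (\<Sum>d\<in>{1..<N}. \<phi> (half * d))"
    using sum_mult_unit[of \<phi> half 2] two_half_cong by (simp add: mult.commute)
  also have "\<dots> = (\<Sum>d\<in>{1..<N}. \<Sum>m\<in>{0..<N}. C (half * d) (m + half * d) * edge m (m + d) e)"
  proof (intro sum.cong refl)
    fix d
    have "[1 * d = 2 * half * d] (mod N)"
      using two_half_cong by (intro cong_scalar_right) (rule cong_sym)
    then have "edge m (m + d) e = edge m (m + 2 * (half * d)) e" for m
      by (intro fun_cong[OF edge_cong] cong_refl cong_add) (simp add: mult.assoc)
    then show "\<phi> (half * d) = (\<Sum>m\<in>{0..<N}. C (half * d) (m + half * d) * edge m (m + d) e)"
      by (simp add: \<phi>)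
  qed
  finally have third: "(\<Sum>d\<in>{1..<N}. \<phi> d) = \<dots>" .
  have second: "(\<Sum>m\<in>{0..<N}. C d m * edge (m - d) m e) =
      (\<Sum>m\<in>{0..<N}. C d (m + d) * edge m (m + d) e)" for d
  proof -
    have "periodic (\<lambda>m. C d m * edge (m - d) m e)"
      unfolding periodic_def
      by (intro allI arg_cong2[where f = "(*)"] ap_weight_cong[OF C] fun_cong[OF edge_cong]
          cong_add cong_diff cong_refl) (simp_all add: cong_def)
    from sum_shift[OF this, of d] show ?thesis by (simp add: algebra_simps)
  qed
  have "(\<Sum>d\<in>{1..<N}. \<Sum>m\<in>{0..<N}. C d m * ap_bd d m e) =
      (\<Sum>d\<in>{1..<N}. (\<Sum>m\<in>{0..<N}. C d m * edge m (m + d) e)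
        + (\<Sum>m\<in>{0..<N}. C d m * edge (m - d) m e)) - (\<Sum>d\<in>{1..<N}. \<phi> d)"
    by (simp add: ap_bd_eq \<phi>_def sum_subtractf sum.distrib algebra_simps)
  also have "\<dots> = (\<Sum>d\<in>{1..<N}. \<Sum>m\<in>{0..<N}. edge_coeff C d m * edge m (m + d) e)"
    unfolding third second edge_coeff_def
    by (simp add: sum_subtractf sum.distrib algebra_simps)
  finally show ?thesis .
qed

lemma edge_coeff_minus:
  assumes C: "ap_weight C"
  shows "edge_coeff C (- d) (m + d) = - edge_coeff C d m"
proof -
  \<comment> \<open>The midpoint reached from either end of the edge is the same modulo
    \<open>N\<close>, since \<open>2 * half = N + 1\<close>.\<close>
  have "m + d + half * - d - (m + half * d) = - N * d"
    using arg_cong[OF two_half, of "\<lambda>x. x * d"] by (simp add: algebra_simps)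
  then have "[m + d + half * - d = m + half * d] (mod N)"
    by (simp add: cong_iff_dvd_diff)
  then have "C (half * - d) (m + d + half * - d) = C (- (half * d)) (m + half * d)"
    by (intro ap_weight_cong[OF C]) auto
  then show ?thesis
    by (simp add: edge_coeff_def ap_weight_minus[OF C])
qed

lemma edge_coeff_cong:
  assumes C: "ap_weight C" and "[d = d'] (mod N)" "[m = m'] (mod N)"
  shows "edge_coeff C d m = edge_coeff C d' m'"
  unfolding edge_coeff_def
  by (intro arg_cong2[where f = "(-)"] arg_cong2[where f = "(+)"] ap_weight_cong[OF C] cong_add
      cong_mult cong_refl assms)

text \<open>Only two ordered pairs run along the edge \<open>e\<close>, one from each end. Reversal
  changes the sign of both the coefficient and the edge chain, so the two contributions agree; hence
  the factor 2.\<close>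

lemma sum_edge_coeff:
  assumes C: "ap_weight C" and d: "\<not> N dvd d" and e: "e = {a mod N, (a + d) mod N}"
  shows "(\<Sum>d\<in>{1..<N}. \<Sum>m\<in>{0..<N}. edge_coeff C d m * edge m (m + d) e) =
         2 * edge_coeff C d a * edge a (a + d) e"
proof -
  define b where "b = a + d"
  have ab: "\<not> [a = b] (mod N)" using d by (simp add: cong_iff_dvd_diff b_def)
  define g where "g m = (\<Sum>d\<in>{1..<N}. edge_coeff C d m * edge m (m + d) e)" for m
  have one: "g (x mod N) = edge_coeff C (y - x) x * edge x y e"
    if "e = {x mod N, y mod N}" "\<not> [x = y] (mod N)" for x y
  proof -
    have "g (x mod N) = (\<Sum>d\<in>{(y - x) mod N}. edge_coeff C d (x mod N) * edge (x mod N) (x mod N + d) e)"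
      unfolding g_def
    proof (rule sum.mono_neutral_right)
      show "{(y - x) mod N} \<subseteq> {1..<N}"
        using that(2) not_dvd_iff[of "y - x"] by (auto simp: cong_iff_dvd_diff dvd_diff_commute)
      show "\<forall>d\<in>{1..<N} - {(y - x) mod N}. edge_coeff C d (x mod N) * edge (x mod N) (x mod N + d) e = 0"
      proof
        fix d assume d: "d \<in> {1..<N} - {(y - x) mod N}"
        have "e \<noteq> {x mod N, (x + d) mod N}"
        proof
          assume "e = {x mod N, (x + d) mod N}"
          with that have "(x + d) mod N = y mod N" by (auto simp: doubleton_eq_iff cong_def)
          then have "d mod N = (y - x) mod N"
            by (metis add_diff_cancel_left' mod_diff_left_eq)
          with d show False by simp
        qed
        then have "edge (x mod N) (x mod N + d) e = 0"
          using edge_nonzero_iff[of "x mod N" "x mod N + d" e] by (simp add: mod_simps)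
        then show "edge_coeff C d (x mod N) * edge (x mod N) (x mod N + d) e = 0" by simp
      qed
    qed simp
    also have "\<dots> = edge_coeff C (y - x) x * edge x y e"
    proof -
      have "edge_coeff C ((y - x) mod N) (x mod N) = edge_coeff C (y - x) x"
        by (intro edge_coeff_cong[OF C]) (simp_all add: cong_def)
      moreover have "edge (x mod N) (x mod N + (y - x) mod N) = edge x y"
        by (intro edge_cong) (simp_all add: cong_def mod_simps)
      ultimately show ?thesis by simp
    qed
    finally show ?thesis .
  qed
  have "(\<Sum>d\<in>{1..<N}. \<Sum>m\<in>{0..<N}. edge_coeff C d m * edge m (m + d) e) = (\<Sum>m\<in>{0..<N}. g m)"
    unfolding g_def by (rule sum.swap)
  also have "\<dots> = (\<Sum>m\<in>{a mod N, b mod N}. g m)"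
  proof (rule sum.mono_neutral_right)
    show "{a mod N, b mod N} \<subseteq> {0..<N}" using gt2 by auto
    show "\<forall>m\<in>{0..<N} - {a mod N, b mod N}. g m = 0"
    proof
      fix m assume m: "m \<in> {0..<N} - {a mod N, b mod N}"
      then have "e \<noteq> {m mod N, (m + d) mod N}" for d
        using e by (auto simp: b_def doubleton_eq_iff)
      then have "edge m (m + d) e = 0" for d
        using edge_nonzero_iff by blast
      then show "g m = 0" by (simp add: g_def)
    qed
  qed simp
  also have "\<dots> = g (a mod N) + g (b mod N)" using ab by (simp add: cong_def)
  also have "\<dots> = edge_coeff C (b - a) a * edge a b e + edge_coeff C (a - b) b * edge b a e"
    using one[of a b] one[of b a] ab e by (simp add: b_def insert_commute cong_sym_eq)
  also have "\<dots> = 2 * edge_coeff C d a * edge a b e"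
    using edge_coeff_minus[OF C, of d a] edge_swap[OF ab] by (simp add: b_def)
  finally show ?thesis by (simp add: b_def)
qed

text \<open>The coefficient at difference \<open>2 * d\<close> and start \<open>m - d\<close> is the
  cycle equation at \<open>d\<close> and \<open>m\<close>. Doubling is invertible modulo
  \<open>N\<close>, so the two systems of equations coincide.\<close>

lemma edge_coeff_zero_iff_cycle:
  assumes C: "ap_weight C"
  shows "(\<forall>d m. edge_coeff C d m = 0) \<longleftrightarrow> ap_cycle C"
proof -
  have cancel: "[half * (2 * d) = d] (mod N)" "[2 * (half * d) = d] (mod N)" for d
    using cong_scalar_right[OF two_half_cong, of d] by (simp_all add: algebra_simps)
  have "C d m = C (2 * d) (m - d) + C (2 * d) (m + d)" if "\<forall>d m. edge_coeff C d m = 0" for d m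
  proof -
    have "edge_coeff C (2 * d) (m - d) = 0" using that by simp
    moreover have "C (half * (2 * d)) (m - d + half * (2 * d)) = C d (m - d + d)"
      by (intro ap_weight_cong[OF C] cancel cong_add cong_refl)
    moreover have "m - d + 2 * d = m + d" by simp
    ultimately show ?thesis by (simp add: edge_coeff_def)
  qed
  moreover have "edge_coeff C d m = 0" if "ap_cycle C" for d m
  proof -
    have "C (half * d) (m + half * d) = C (2 * (half * d)) m + C (2 * (half * d)) (m + 2 * (half * d))"
      using that[unfolded ap_cycle_def, rule_format, of "half * d" "m + half * d"]
      by (simp add: algebra_simps)
    also have "\<dots> = C d m + C d (m + d)"
      by (intro arg_cong2[where f = "(+)"] ap_weight_cong[OF C] cancel cong_add cong_refl)
    finally show ?thesis by (simp add: edge_coeff_def)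
  qed
  ultimately show ?thesis unfolding ap_cycle_def by blast
qed

text \<open>The range \<open>{1..<half}\<close> meets each pair \<open>d\<close>, \<open>- d\<close>
  once; as weight and boundary are both odd in \<open>d\<close>, the sum over all nonzero
  \<open>d\<close> is twice this one. Evaluation at the edge between \<open>m\<close> and
  \<open>m + d\<close> isolates \<open>edge_coeff C d m\<close>.\<close>

lemma ap_cycle_iff:
  assumes C: "ap_weight C"
  shows "ap_cycle C \<longleftrightarrow> (\<forall>e. (\<Sum>d\<in>{1..<half}. \<Sum>m\<in>{0..<N}. C d m * ap_bd d m e) = 0)"
proof -
  have "(\<Sum>d\<in>{1..<N}. \<Sum>m\<in>{0..<N}. C d m * ap_bd d m e) =
      2 * (\<Sum>d\<in>{1..<half}. \<Sum>m\<in>{0..<N}. C d m * ap_bd d m e)" for e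
  proof (rule sum_fold_sign)
    show "periodic (\<lambda>d. \<Sum>m\<in>{0..<N}. C d m * ap_bd d m e)"
      unfolding periodic_def
      by (intro allI sum.cong refl arg_cong2[where f = "(*)"] ap_weight_cong[OF C]
          fun_cong[OF ap_bd_cong]) (simp_all add: cong_def)
    show "(\<Sum>m\<in>{0..<N}. C (- d) m * ap_bd (- d) m e) = (\<Sum>m\<in>{0..<N}. C d m * ap_bd d m e)"
      if "d \<in> {1..<N}" for d
      using that by (simp add: ap_weight_minus[OF C] ap_bd_minus zdvd_not_zless)
  qed
  then have sum: "(\<Sum>d\<in>{1..<N}. \<Sum>m\<in>{0..<N}. edge_coeff C d m * edge m (m + d) e) =
      2 * (\<Sum>d\<in>{1..<half}. \<Sum>m\<in>{0..<N}. C d m * ap_bd d m e)" for e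
    by (simp add: sum_ap_bd[OF C])
  show ?thesis
  proof
    assume "ap_cycle C"
    then have "edge_coeff C d m = 0" for d m using edge_coeff_zero_iff_cycle[OF C] by simp
    then show "\<forall>e. (\<Sum>d\<in>{1..<half}. \<Sum>m\<in>{0..<N}. C d m * ap_bd d m e) = 0"
      using sum by simp
  next
    assume zero: "\<forall>e. (\<Sum>d\<in>{1..<half}. \<Sum>m\<in>{0..<N}. C d m * ap_bd d m e) = 0"
    have "edge_coeff C d m = 0" for d m
    proof (cases "N dvd d")
      \<comment> \<open>No edge tests this coefficient; it vanishes because an odd weight is zero at
        difference 0.\<close>
      case True
      then have d0: "[d = 0] (mod N)" by (simp add: cong_0_iff)
      have "edge_coeff C d m = edge_coeff C 0 m" using d0 by (intro edge_coeff_cong[OF C]) auto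
      moreover have "C 0 m = 0" using ap_weight_minus[OF C, of 0 m] by simp
      ultimately show ?thesis by (simp add: edge_coeff_def)
    next
      case False
      define e where "e = {m mod N, (m + d) mod N}"
      have "2 * edge_coeff C d m * edge m (m + d) e = 0"
        using sum_edge_coeff[OF C False e_def] sum[of e] zero by simp
      moreover have "edge m (m + d) e \<noteq> 0" by (simp add: edge_nonzero_iff e_def)
      ultimately show ?thesis by simp
    qed
    then show "ap_cycle C" using edge_coeff_zero_iff_cycle[OF C] by blast
  qed
qed

end

section \<open>Cycles and cosets\<close>

context odd_prime_modulus
begin

text \<open>On units this says that both lie in the same coset of the subgroup generated by -1 and
  2. Natural exponents suffice because 2 has finite order.\<close>

definition pm_pow2 :: "int \<Rightarrow> int \<Rightarrow> bool" where
  "pm_pow2 d d' \<longleftrightarrow> (\<exists>k::nat. [d' = 2 ^ k * d] (mod N) \<or> [d' = - (2 ^ k * d)] (mod N))"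

lemma pm_pow2I: "[d' = 2 ^ k * d] (mod N) \<Longrightarrow> pm_pow2 d d'" "[d' = - (2 ^ k * d)] (mod N) \<Longrightarrow> pm_pow2 d d'"
  unfolding pm_pow2_def by blast+

lemma pm_pow2_refl: "[d = d'] (mod N) \<Longrightarrow> pm_pow2 d d'"
  using pm_pow2I(1)[of d' 0 d] by (simp add: cong_sym)

lemma pm_pow2_minus: "[d' = - d] (mod N) \<Longrightarrow> pm_pow2 d d'"
  using pm_pow2I(2)[of d' 0 d] by simp

lemma pm_pow2_double: "pm_pow2 d (2 * d)"
  using pm_pow2I(1)[of "2 * d" 1 d] by simp

lemma pm_pow2_trans:
  assumes "pm_pow2 a b" "pm_pow2 b c"
  shows "pm_pow2 a c"
proof -
  obtain k s where k: "[b = s * (2 ^ k * a)] (mod N)" and s: "s = 1 \<or> s = -1"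
    using assms(1) unfolding pm_pow2_def by (metis mult_1 mult_minus1)
  obtain l t where l: "[c = t * (2 ^ l * b)] (mod N)" and t: "t = 1 \<or> t = -1"
    using assms(2) unfolding pm_pow2_def by (metis mult_1 mult_minus1)
  note l
  also have "[t * (2 ^ l * b) = t * (2 ^ l * (s * (2 ^ k * a)))] (mod N)"
    by (intro cong_scalar_left k)
  also have "t * (2 ^ l * (s * (2 ^ k * a))) = t * s * (2 ^ (l + k) * a)"
    by (simp add: power_add)
  finally show ?thesis using s t by (auto intro: pm_pow2I)
qed

text \<open>By Fermat, \<open>2 ^ (N - 2)\<close> inverts 2, so the inverse of \<open>2 ^ k\<close>
  is again a natural power of 2.\<close>

lemma pm_pow2_sym:
  assumes "pm_pow2 a b" shows "pm_pow2 b a"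
proof -
  obtain k s where k: "[b = s * (2 ^ k * a)] (mod N)" and s: "s = 1 \<or> s = -1"
    using assms unfolding pm_pow2_def by (metis mult_1 mult_minus1)
  define M where "M = nat N - 2"
  have M: "M + 1 = nat N - 1" using gt2 by (simp add: M_def)
  have "[(2 ^ (nat N - 1)) ^ k = 1 ^ k] (mod N)" by (intro cong_pow fermat)
  then have "[(2 ^ (nat N - 1)) ^ k * a = 1 * a] (mod N)" by (intro cong_scalar_right) simp
  moreover have "(2 ^ (nat N - 1)) ^ k * a = s * 2 ^ (M * k) * (s * (2 ^ k * a))"
    using s unfolding M[symmetric] by (auto simp: power_add power_mult power_mult_distrib)
  moreover have "[s * 2 ^ (M * k) * (s * (2 ^ k * a)) = s * 2 ^ (M * k) * b] (mod N)"
    by (intro cong_scalar_left cong_sym[OF k])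
  ultimately have "[a = s * 2 ^ (M * k) * b] (mod N)"
    by (metis cong_sym cong_trans mult_1)
  then show ?thesis using s by (auto intro: pm_pow2I simp: mult.assoc)
qed

lemma cycle_diff_pm2:
  assumes C: "ap_weight C" and cyc: "ap_cycle C" and "pm_pow2 d d'"
  shows "C d' (m + d') - C d' (m - d') = C d (m + d) - C d (m - d)"
proof -
  define f where "f d m = C d (m + d) - C d (m - d)" for d m
  have f_cong: "f a m = f b m" if "[a = b] (mod N)" for a b m
    unfolding f_def
    by (intro arg_cong2[where f = "(-)"] ap_weight_cong[OF C] cong_add cong_diff cong_refl that)
  have f_minus: "f (- d) m = f d m" for d m
    by (simp add: f_def ap_weight_minus[OF C])
  \<comment> \<open>The cycle equations at \<open>m + d\<close> and \<open>m - d\<close> share the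
    term \<open>C (2 * d) m\<close>, which cancels in the difference.\<close>
  have f_double: "f (2 * d) m = f d m" for d m
  proof -
    have "C d (m + d) = C (2 * d) m + C (2 * d) (m + 2 * d)"
      using cyc[unfolded ap_cycle_def, rule_format, of d "m + d"] by (simp add: algebra_simps)
    moreover have "C d (m - d) = C (2 * d) (m - 2 * d) + C (2 * d) m"
      using cyc[unfolded ap_cycle_def, rule_format, of d "m - d"] by (simp add: algebra_simps)
    ultimately show ?thesis by (simp add: f_def)
  qed
  have f_pow: "f (2 ^ k * d) m = f d m" for k m
    by (induction k) (simp_all add: f_double mult.assoc)
  obtain k where "[d' = 2 ^ k * d] (mod N) \<or> [d' = - (2 ^ k * d)] (mod N)"
    using assms(3) unfolding pm_pow2_def by blast
  then have "f d' m = f d m" using f_cong f_minus f_pow by metis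
  then show ?thesis by (simp add: f_def)
qed

lemma cycle_sum_zero:
  assumes C: "ap_weight C" and cyc: "ap_cycle C"
  shows "(\<Sum>m\<in>{0..<N}. C d m) = 0"
proof -
  define s where "s d = (\<Sum>m\<in>{0..<N}. C d m)" for d
  have step: "s d = 2 * s (2 * d)" for d
  proof -
    have "s d = (\<Sum>m\<in>{0..<N}. C (2 * d) (m + - d)) + (\<Sum>m\<in>{0..<N}. C (2 * d) (m + d))"
      unfolding s_def sum.distrib[symmetric]
      using cyc[unfolded ap_cycle_def, rule_format, of d] by (intro sum.cong refl) simp
    also have "\<dots> = 2 * s (2 * d)"
      by (simp only: sum_shift[OF ap_weight_periodic(1)[OF C]] s_def mult_2)
    finally show ?thesis .
  qed
  have pow: "s d = 2 ^ k * s (2 ^ k * d)" for k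
  proof (induction k)
    case (Suc k)
    then show ?case using step[of "2 ^ k * d"] by (simp add: mult.assoc)
  qed simp
  have "s (2 ^ (nat N - 1) * d) = s d"
    unfolding s_def
    using cong_scalar_right[OF fermat, of d] by (intro sum.cong refl ap_weight_cong[OF C]) auto
  with pow[of "nat N - 1"] have "(2 ^ (nat N - 1) - 1) * s d = 0" by (simp add: algebra_simps)
  moreover have "(2::rat) ^ (nat N - 1) > 1" using gt2 by (intro one_less_power) auto
  ultimately show ?thesis by (simp add: s_def)
qed

text \<open>The zero sum forces the remaining value \<open>C d0 0\<close> to vanish as well. The
  common difference of the whole class is then zero, and \<open>C d\<close> is a constant of sum
  zero. This is the independence half of the rank computation.\<close>

lemma cycle_zero:
  assumes C: "ap_weight C" and cyc: "ap_cycle C" and d: "\<not> N dvd d" and rel: "pm_pow2 d0 d"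
    and zero: "\<And>m. \<not> N dvd m \<Longrightarrow> C d0 m = 0"
  shows "C d m = 0"
proof -
  have eq0: "C d0 m = 0" for m
  proof (cases "N dvd m")
    case True
    have "{0..<N} = insert 0 {1..<N}" using gt2 by auto
    then have "0 = C d0 0 + (\<Sum>m\<in>{1..<N}. C d0 m)"
      using cycle_sum_zero[OF C cyc, of d0] by simp
    also have "(\<Sum>m\<in>{1..<N}. C d0 m) = 0"
      by (intro sum.neutral) (auto intro!: zero simp: zdvd_not_zless)
    finally have "C d0 0 = 0" by simp
    moreover have "C d0 m = C d0 0" using True by (intro ap_weight_cong[OF C]) (auto simp: cong_0_iff)
    ultimately show ?thesis by simp
  qed (rule zero)
  show ?thesis
    using cycle_diff_pm2[OF C cyc rel] cycle_sum_zero[OF C cyc, of d]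
    by (intro periodic_diff_unique[OF ap_weight_periodic(1)[OF C] _ d, where q = "\<lambda>_. 0"])
       (simp_all add: eq0 periodic_def)
qed

text \<open>At \<open>d0\<close> the cycle is a point mass at \<open>m0\<close> minus one at 0. It
  therefore expresses the face \<open>(d0, m0)\<close> through \<open>(d0, 0)\<close> and faces with
  other differences of the class, which is the spanning half.\<close>

lemma cycle_exists:
  assumes d0: "\<not> N dvd d0"
  obtains C where "ap_weight C" "ap_cycle C"
    "\<And>m. C d0 m = of_bool (N dvd m - m0) - of_bool (N dvd m)"
    "\<And>d m. \<not> pm_pow2 d0 d \<Longrightarrow> C d m = 0"
proof -
  define p :: "int \<Rightarrow> rat" where "p m = of_bool (N dvd m - m0) - of_bool (N dvd m)" for m
  have p: "periodic p"
  proof -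
    have "N dvd x mod N - m0 \<longleftrightarrow> N dvd x - m0" for x
      by (simp add: dvd_eq_mod_eq_0 mod_simps)
    then show ?thesis by (simp add: periodic_def p_def dvd_mod_iff)
  qed
  have sum_p: "(\<Sum>m\<in>{0..<N}. p m) = 0"
  proof -
    define q :: "int \<Rightarrow> rat" where "q m = of_bool (N dvd m)" for m
    have "periodic q" by (simp add: periodic_def q_def dvd_mod_iff)
    from sum_shift[OF this, of "- m0"] show ?thesis
      by (simp add: p_def q_def sum_subtractf)
  qed
  \<comment> \<open>The difference that a cycle equal to \<open>p\<close> at \<open>d0\<close> must
    have at every \<open>d\<close> of the class; \<open>antidiff\<close> recovers the cycle from
    it.\<close>
  define f where "f m = p (m + d0) - p (m - d0)" for m
  have f: "periodic f"
    using periodic_shift[OF p, of d0] periodic_shift[OF p, of "- d0"] by (simp add: periodic_def f_def)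
  have sum_f: "(\<Sum>m\<in>{0..<N}. f m) = 0"
    using sum_shift[OF p, of d0] sum_shift[OF p, of "- d0"] by (simp add: f_def sum_subtractf)
  have u_per: "periodic (antidiff f d)" for d by (rule antidiff_periodic[OF f])
  have u_step: "antidiff f d (m + d) - antidiff f d (m - d) = f m" if "\<not> N dvd d" for d m
    by (rule antidiff_step[OF f sum_f that])
  have u_sum: "(\<Sum>m\<in>{0..<N}. antidiff f d m) = 0" for d
    by (rule sum_antidiff[OF f sum_f])
  \<comment> \<open>A periodic solution of sum zero is unique, so oddness, the cycle equation and
    the value at \<open>d0\<close> are each checked on differences and sums alone.\<close>
  have u_minus: "antidiff f (- d) m = - antidiff f d m" if d: "\<not> N dvd d" for d m
  proof (rule periodic_diff_unique[OF u_per _ d])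
    show "periodic (\<lambda>m. - antidiff f d m)" using u_per by (simp add: periodic_def)
    show "antidiff f (- d) (m + d) - antidiff f (- d) (m - d) =
        - antidiff f d (m + d) - - antidiff f d (m - d)" for m
      using u_step[of "- d" m] u_step[OF d, of m] d by simp
  qed (simp add: u_sum sum_negf)
  have u_double: "antidiff f d m = antidiff f (2 * d) (m - d) + antidiff f (2 * d) (m + d)"
    if d: "\<not> N dvd d" for d m
  proof (rule periodic_diff_unique[OF u_per _ d])
    show "periodic (\<lambda>m. antidiff f (2 * d) (m - d) + antidiff f (2 * d) (m + d))"
      using periodic_shift[OF u_per, of "2 * d" d] periodic_shift[OF u_per, of "2 * d" "- d"]
      by (simp add: periodic_def)
    show "antidiff f d (m + d) - antidiff f d (m - d) =
        antidiff f (2 * d) (m + d - d) + antidiff f (2 * d) (m + d + d) -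
        (antidiff f (2 * d) (m - d - d) + antidiff f (2 * d) (m - d + d))" for m
      using u_step[OF d, of m] u_step[OF not_dvd_mult[OF not_dvd_two d], of m]
      by (simp add: algebra_simps)
    show "(\<Sum>m\<in>{0..<N}. antidiff f d m) =
        (\<Sum>m\<in>{0..<N}. antidiff f (2 * d) (m - d) + antidiff f (2 * d) (m + d))"
      using sum_shift[OF u_per, of "2 * d" d] sum_shift[OF u_per, of "2 * d" "- d"]
      by (simp add: sum.distrib u_sum)
  qed
  have u_d0: "antidiff f d0 m = p m" for m
    using u_step[OF d0] by (intro periodic_diff_unique[OF u_per p d0]) (simp_all add: u_sum sum_p f_def)
  \<comment> \<open>Cutting off outside one class preserves both equations, because the class is
    stable under negation and doubling.\<close>
  define C where "C d m = (if \<not> N dvd d \<and> pm_pow2 d0 d then antidiff f d m else 0)" for d m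
  have rel_mod: "pm_pow2 d0 (d mod N) \<longleftrightarrow> pm_pow2 d0 d" for d
    by (meson cong_mod_left cong_refl cong_sym pm_pow2_refl pm_pow2_trans)
  have rel_minus: "pm_pow2 d0 (- d) \<longleftrightarrow> pm_pow2 d0 d" for d
    by (metis cong_refl minus_minus pm_pow2_minus pm_pow2_trans)
  have rel_double: "pm_pow2 d0 (2 * d) \<longleftrightarrow> pm_pow2 d0 d" for d
    using pm_pow2_double pm_pow2_sym pm_pow2_trans by blast
  have dvd_double: "N dvd 2 * d \<longleftrightarrow> N dvd d" for d
    using prime_dvd_mult_iff[OF prime] not_dvd_two by simp
  show ?thesis
  proof
    have "antidiff f (d mod N) (m mod N) = antidiff f d m" for d m
      using antidiff_cong[OF f, of "d mod N" d] u_per[of d] by (simp add: periodic_def)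
    then show "ap_weight C"
      by (simp add: ap_weight_def C_def rel_mod rel_minus u_minus dvd_mod_iff)
    show "ap_cycle C"
      using u_double by (simp add: ap_cycle_def C_def rel_double dvd_double)
    show "C d0 m = of_bool (N dvd m - m0) - of_bool (N dvd m)" for m
      using d0 pm_pow2_refl[of d0 d0] by (simp add: C_def u_d0 p_def)
    show "C d m = 0" if "\<not> pm_pow2 d0 d" for d m using that by (simp add: C_def)
  qed
qed

text \<open>Taking least elements makes 1 the representative of its own class, the one class that
  must be treated separately.\<close>

definition class_reps :: "int set" where
  "class_reps = {d \<in> {1..<half}. \<forall>d'\<in>{1..<half}. pm_pow2 d' d \<longrightarrow> d \<le> d'}"

lemma half_range: "d \<in> {1..<half} \<Longrightarrow> \<not> N dvd d" "1 < half" "half < N"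
  using two_half gt2 zdvd_not_zless[of d N] by auto

lemma class_rep_exists:
  assumes d: "\<not> N dvd d"
  obtains d0 where "d0 \<in> class_reps" "pm_pow2 d0 d"
proof -
  define A where "A = {d' \<in> {1..<half}. pm_pow2 d' d}"
  have "A \<noteq> {}"
  proof (cases "d mod N < half")
    case True
    then have "d mod N \<in> A"
      using d not_dvd_iff[of d] by (auto simp: A_def intro: pm_pow2_refl)
    then show ?thesis by blast
  next
    case False
    have "[d = - (N - d mod N)] (mod N)" by (simp add: cong_def mod_simps)
    then have "pm_pow2 (N - d mod N) d" by (rule pm_pow2_minus)
    then have "N - d mod N \<in> A"
      using d not_dvd_iff[of d] False two_half by (auto simp: A_def)
    then show ?thesis by blast
  qed
  moreover have fin: "finite A" by (rule finite_subset[of _ "{1..<half}"]) (auto simp: A_def)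
  ultimately have Min: "Min A \<in> A" by (rule Min_in[rotated])
  moreover have "Min A \<le> d'" if "d' \<in> {1..<half}" "pm_pow2 d' (Min A)" for d'
  proof (rule Min_le[OF fin])
    show "d' \<in> A" using that Min pm_pow2_trans by (auto simp: A_def)
  qed
  ultimately have "Min A \<in> class_reps" by (auto simp: A_def class_reps_def)
  then show ?thesis using that Min by (auto simp: A_def)
qed

lemma class_reps_unique:
  assumes "d \<in> class_reps" "d' \<in> class_reps" "pm_pow2 d d'"
  shows "d = d'"
  using assms pm_pow2_sym[OF assms(3)] unfolding class_reps_def by (simp add: order_antisym)

lemma one_class_rep: "1 \<in> class_reps"
  using half_range by (auto simp: class_reps_def)

lemma finite_class_reps: "finite class_reps"
  by (rule finite_subset[of _ "{1..<half}"]) (auto simp: class_reps_def)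

text \<open>Pairs of a difference, taken up to sign, and a centre. The range starts at 2 because
  differences 1 and -1 are excluded.\<close>

definition face_index :: "(int \<times> int) set" where
  "face_index = {2..<half} \<times> {0..<N}"

text \<open>For each class other than that of 1, the faces of one difference are deleted except the
  one centred at 0, which accounts for the \<open>N - 1\<close> free values of a function of sum
  zero.\<close>

definition face_basis :: "(int \<times> int) set" where
  "face_basis = face_index - (class_reps - {1}) \<times> {1..<N}"

lemma card_face_basis:
  "int (card face_basis) = int (card face_index) - (N - 1) * (int (card class_reps) - 1)"
proof -
  have sub: "(class_reps - {1}) \<times> {1..<N} \<subseteq> face_index"
    by (auto simp: face_index_def class_reps_def)
  have "card face_basis = card face_index - card ((class_reps - {1}) \<times> {1..<N})"
    unfolding face_basis_def by (intro card_Diff_subset sub) (simp add: finite_class_reps)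
  moreover have "card ((class_reps - {1}) \<times> {1..<N}) \<le> card face_index"
    by (intro card_mono sub) (simp add: face_index_def)
  moreover have "card ((class_reps - {1}) \<times> {1..<N}) = (card class_reps - 1) * nat (N - 1)"
    using one_class_rep finite_class_reps by (simp add: card_cartesian_product)
  moreover have "card class_reps \<ge> 1"
    using one_class_rep finite_class_reps by (simp add: Suc_le_eq card_gt_0_iff) blast
  ultimately show ?thesis using gt2 by (simp add: of_nat_diff)
qed

end

lemma rat_combination_apply:
  "(\<Sum>i\<in>A. (\<lambda>e. (c i :: rat) * v i e)) e = (\<Sum>i\<in>A. c i * v i e)"
  by (induction A rule: infinite_finite_induct) simp_all

section \<open>A basis of the column space\<close>

context ap_boundary
begin

lemma rank_ap_bd: "rat_fun.dim ((\<lambda>(d, m). ap_bd d m) ` face_index) = card face_basis"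
proof (rule rat_fun.dim_image_eq_card)
  have fin: "finite face_index" by (simp add: face_index_def)
  then show "finite face_basis" by (simp add: face_basis_def)
  show sub: "face_basis \<subseteq> face_index" by (auto simp: face_basis_def)
  \<comment> \<open>A weight vanishing at difference 1 involves genuine faces only, so the cycle
    criterion becomes a sum over \<open>face_index\<close>.\<close>
  have sum_index: "(\<Sum>d\<in>{1..<half}. \<Sum>m\<in>{0..<N}. C d m * ap_bd d m e) =
      (\<Sum>(d, m)\<in>face_index. C d m * ap_bd d m e)" if "\<And>m. C 1 m = 0" for C e
  proof -
    have "{1..<half} = insert 1 {2..<half}" using half_range(2) by auto
    then have "(\<Sum>d\<in>{1..<half}. \<Sum>m\<in>{0..<N}. C d m * ap_bd d m e) =
        (\<Sum>d\<in>{2..<half}. \<Sum>m\<in>{0..<N}. C d m * ap_bd d m e)"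
      by (simp add: that)
    then show ?thesis by (simp only: face_index_def sum.cartesian_product)
  qed
  show "\<forall>i\<in>face_basis. c i = 0"
    if "(\<Sum>i\<in>face_basis. (\<lambda>e. c i * (case i of (d, m) \<Rightarrow> ap_bd d m) e)) = 0" for c
  proof -
    define g where "g d m = (if (d, m) \<in> face_basis then c (d, m) else 0)" for d m
    \<comment> \<open>The odd extension of the given coefficients. For \<open>d\<close> below
      \<open>half\<close> the reflected index is outside \<open>face_basis\<close>, so
      \<open>C\<close> restricts to \<open>c\<close> there.\<close>
    define C where "C d m = g (d mod N) (m mod N) - g ((- d) mod N) (m mod N)" for d m
    have C: "ap_weight C" by (simp add: ap_weight_def C_def mod_simps)
    have C_eq: "C d m = g d (m mod N)" if "d \<in> {0..<half}" for d m
    proof (cases "d = 0")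
      case True
      then show ?thesis by (auto simp: C_def g_def face_basis_def face_index_def)
    next
      case False
      have "(- d) mod N = N - d" using False that half_range(3) by (simp add: zmod_zminus1_eq_if)
      moreover have "N - d \<ge> half" using that two_half by auto
      ultimately have "g ((- d) mod N) (m mod N) = 0"
        by (auto simp: g_def face_basis_def face_index_def)
      then show ?thesis using that half_range(3) by (simp add: C_def)
    qed
    have "C 1 m = 0" for m
      using C_eq[of 1 m] half_range(2) by (simp add: g_def face_basis_def face_index_def)
    note sum_C = sum_index[of C, OF this]
    have "(\<Sum>d\<in>{1..<half}. \<Sum>m\<in>{0..<N}. C d m * ap_bd d m e) = 0" for e
    proof -
      have "(\<Sum>(d, m)\<in>face_index. C d m * ap_bd d m e) = (\<Sum>(d, m)\<in>face_basis. C d m * ap_bd d m e)"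
        using fin sub by (intro sum.mono_neutral_right) (auto simp: face_index_def C_eq g_def)
      also have "\<dots> = (\<Sum>i\<in>face_basis. c i * (case i of (d, m) \<Rightarrow> ap_bd d m) e)"
        using sub by (intro sum.cong) (auto simp: face_index_def C_eq g_def)
      also have "\<dots> = 0"
        using fun_cong[OF that, of e] by (simp add: rat_combination_apply)
      finally show ?thesis by (simp only: sum_C)
    qed
    then have cyc: "ap_cycle C" using ap_cycle_iff[OF C] by simp
    have zero: "C d m = 0" if "\<not> N dvd d" for d m
    proof -
      obtain d0 where d0: "d0 \<in> class_reps" "pm_pow2 d0 d" using class_rep_exists \<open>\<not> N dvd d\<close> by blast
      have "C d0 m = 0" if "\<not> N dvd m" for m
      proof -
        \<comment> \<open>Either \<open>d0 = 1\<close>, which is below the range of differences, or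
          the pair is one of the deleted ones because \<open>m\<close> is nonzero modulo
          \<open>N\<close>.\<close>
        have "(d0, m mod N) \<notin> face_basis"
          using d0(1) not_dvd_iff[of m] that by (cases "d0 = 1") (auto simp: face_basis_def face_index_def)
        then show ?thesis using d0(1) by (simp add: C_eq class_reps_def g_def)
      qed
      then show ?thesis using cycle_zero[OF C cyc that d0(2)] by blast
    qed
    show ?thesis
    proof
      fix i assume i: "i \<in> face_basis"
      obtain d m where dm: "i = (d, m)" by fastforce
      have "d \<in> {1..<half}" "m \<in> {0..<N}" using i sub dm by (auto simp: face_index_def)
      then show "c i = 0" using zero[of d m] C_eq[of d m] half_range(1)[of d] i
        by (simp add: g_def dm)
    qed
  qed
  show "(case i of (d, m) \<Rightarrow> ap_bd d m) \<in> rat_fun.span ((\<lambda>(d, m). ap_bd d m) ` face_basis)"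
    if "i \<in> face_index - face_basis" for i
  proof -
    obtain d0 m0 where i: "i = (d0, m0)" by fastforce
    have d0: "d0 \<in> class_reps" "d0 \<noteq> 1" and m0: "m0 \<in> {1..<N}"
      using that i by (auto simp: face_basis_def)
    have unit: "\<not> N dvd d0" using d0 half_range(1) by (auto simp: class_reps_def)
    obtain C where C: "ap_weight C" and cyc: "ap_cycle C"
      and C0: "\<And>m. C d0 m = of_bool (N dvd m - m0) - of_bool (N dvd m)"
      and Cz: "\<And>d m. \<not> pm_pow2 d0 d \<Longrightarrow> C d m = 0"
      using cycle_exists[OF unit] by blast
    have "C 1 m = 0" for m
      using class_reps_unique[OF d0(1) one_class_rep] d0(2) Cz by blast
    then have sum0: "(\<Sum>(d, m)\<in>face_index. C d m * ap_bd d m e) = 0" for e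
      using cyc[unfolded ap_cycle_iff[OF C], rule_format, of e] sum_index[of C e] by simp
    have C1: "C d0 m0 = 1" using C0[of m0] m0 by (simp add: zdvd_not_zless)
    \<comment> \<open>Among the deleted faces the cycle sees only \<open>(d0, m0)\<close>: another
      one in the same class has difference \<open>d0\<close> and a centre different from both
      \<open>m0\<close> and 0. The cycle relation can thus be solved for that single column.\<close>
    have Cout: "C d m = 0" if "(d, m) \<in> face_index - face_basis" "(d, m) \<noteq> (d0, m0)" for d m
    proof (cases "pm_pow2 d0 d")
      case True
      have d: "d \<in> class_reps" and m: "m \<in> {1..<N}" using that by (auto simp: face_basis_def)
      have "d = d0" using class_reps_unique[OF d0(1) d True] by simp
      then have "m \<noteq> m0" using that by simp
      then have "\<not> N dvd m - m0"
        using m m0 zdvd_imp_le[of N "m - m0"] zdvd_imp_le[of N "m0 - m"]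
        by (auto simp: dvd_diff_commute not_le intro: linorder_cases[of m m0])
      then show ?thesis using m \<open>d = d0\<close> by (simp add: C0 zdvd_not_zless)
    qed (rule Cz)
    have bd_eq: "ap_bd d0 m0 e = - (\<Sum>(d, m)\<in>face_basis. C d m * ap_bd d m e)" for e
    proof -
      have "0 = (\<Sum>(d, m)\<in>insert (d0, m0) face_basis. C d m * ap_bd d m e)"
        unfolding sum0[of e, symmetric]
      proof (rule sum.mono_neutral_right[OF fin])
        show "insert (d0, m0) face_basis \<subseteq> face_index" using sub that i by blast
        show "\<forall>j\<in>face_index - insert (d0, m0) face_basis. (case j of (d, m) \<Rightarrow> C d m * ap_bd d m e) = 0"
        proof
          fix j assume j: "j \<in> face_index - insert (d0, m0) face_basis"
          obtain d m where "j = (d, m)" by fastforce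
          then show "(case j of (d, m) \<Rightarrow> C d m * ap_bd d m e) = 0"
            using Cout[of d m] j by simp
        qed
      qed
      also have "\<dots> = ap_bd d0 m0 e + (\<Sum>(d, m)\<in>face_basis. C d m * ap_bd d m e)"
        using that i finite_subset[OF sub fin] by (simp add: C1)
      finally show ?thesis by simp
    qed
    have "ap_bd d0 m0 =
        (\<Sum>j\<in>face_basis. (\<lambda>e. (- case_prod C j) * (case j of (d, m) \<Rightarrow> ap_bd d m) e))"
      unfolding fun_eq_iff rat_combination_apply by (simp add: bd_eq sum_negf case_prod_unfold)
    also have "\<dots> \<in> rat_fun.span ((\<lambda>(d, m). ap_bd d m) ` face_basis)"
      by (intro rat_fun.span_sum rat_fun.span_scale rat_fun.span_base imageI)
    finally show ?thesis by (simp add: i)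
  qed
qed

end

section \<open>The index of the subgroup generated by 2\<close>

context odd_prime_modulus
begin

lemma int_nat_N: "int (nat N) = N"
  using gt2 by simp

abbreviation U :: "int monoid" where "U \<equiv> units_of (residue_ring N)"

lemma carrier_Zmod: "carrier (residue_ring N) = {0..<N}"
  using gt2 by (auto simp: residue_ring_def)

lemma residues_prime_N: "residues_prime (nat N)"
proof -
  have "prime (nat N)" using prime prime_int_nat_transfer by blast
  then show ?thesis by (rule residues_prime.intro)
qed

lemma residues_N: "residues N"
  using gt2 by unfold_locales simp

lemma Zmod_minus_one: "\<ominus>\<^bsub>residue_ring N\<^esub> \<one>\<^bsub>residue_ring N\<^esub> = N - 1"
  using residues.res_neg_eq[OF residues_N, of 1] residues.res_one_eq[OF residues_N] gt2
  by (simp add: zmod_zminus1_eq_if)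

lemma pm_one_eq: "pm_one (nat N) = {1, N - 1}"
  unfolding pm_one_def int_nat_N Zmod_minus_one by (simp add: residue_ring_def)

lemma two_res_eq: "two_res (nat N) = 2"
  using gt2 by (simp add: two_res_def residue_ring_def)

lemma carrier_U: "carrier U = {1..<N}"
proof -
  have "Units (residue_ring N) = {1..N - 1}"
    using residues_prime.res_prime_units_eq[OF residues_prime_N] gt2
    by (simp only: int_nat_N of_nat_diff) simp
  also have "\<dots> = {1..<N}" by auto
  finally show ?thesis by (simp only: units_of_carrier)
qed

lemma mult_U: "x \<otimes>\<^bsub>U\<^esub> y = x * y mod N"
  using gt2 by (simp add: units_of_mult residue_ring_def)

lemma one_U: "\<one>\<^bsub>U\<^esub> = 1"
  by (simp add: units_of_one residue_ring_def)

lemma comm_group_U: "comm_group U"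
  using comm_monoid.units_comm_group[OF residues.comm_monoid[OF residues_N]] .

lemma group_U: "group U"
  using comm_group_U by (rule comm_group.axioms)

lemma cong_mult_U: "[x \<otimes>\<^bsub>U\<^esub> y = x * y] (mod N)"
  by (simp add: mult_U cong_def)

lemma mod_in_U: "\<not> N dvd x \<Longrightarrow> x mod N \<in> carrier U"
  using not_dvd_iff[of x] by (simp only: carrier_U)

lemma U_not_dvd: "x \<in> carrier U \<Longrightarrow> \<not> N dvd x"
  by (simp add: carrier_U zdvd_not_zless)

lemma N_minus_one_U: "(N - 1) \<otimes>\<^bsub>U\<^esub> x = (- x) mod N"
proof -
  have "(N - 1) * x = - x + N * x" by (simp add: algebra_simps)
  then show ?thesis by (simp only: mult_U mod_mult_self2)
qed

lemma subgroup_pm_one: "subgroup (pm_one (nat N)) U"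
proof -
  interpret U: group U by (rule group_U)
  have sq: "(N - 1) \<otimes>\<^bsub>U\<^esub> (N - 1) = \<one>\<^bsub>U\<^esub>"
    unfolding N_minus_one_U one_U using gt2 by (simp add: zmod_zminus1_eq_if)
  have mem: "N - 1 \<in> carrier U" "1 \<in> carrier U" using gt2 by (simp_all add: carrier_U)
  have inv: "inv\<^bsub>U\<^esub> (N - 1) = N - 1" using sq mem by (intro U.inv_equality)
  show ?thesis
    unfolding pm_one_eq
  proof (rule U.subgroupI)
    show "{1, N - 1} \<subseteq> carrier U" using mem by simp
    show "inv\<^bsub>U\<^esub> a \<in> {1, N - 1}" if "a \<in> {1, N - 1}" for a
      using that inv U.inv_one by (auto simp: one_U)
    show "a \<otimes>\<^bsub>U\<^esub> b \<in> {1, N - 1}" if "a \<in> {1, N - 1}" "b \<in> {1, N - 1}" for a b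
      using that sq mem U.l_one U.r_one by (auto simp: one_U)
  qed simp
qed

lemma normal_pm_one: "pm_one (nat N) \<lhd> U"
  using comm_group.subgroup_imp_normal[OF comm_group_U subgroup_pm_one] .

text \<open>The class of an integer in the quotient by the signs. Reducing first allows integers
  such as \<open>2 ^ k\<close> as arguments.\<close>

definition proj :: "int \<Rightarrow> int set" where
  "proj x = pm_one (nat N) #>\<^bsub>U\<^esub> (x mod N)"

lemma proj_eq: "proj x = {x mod N, (- x) mod N}"
proof -
  have "proj x = {1 \<otimes>\<^bsub>U\<^esub> (x mod N), (N - 1) \<otimes>\<^bsub>U\<^esub> (x mod N)}"
    by (simp add: proj_def pm_one_eq r_coset_def insert_commute)
  then show ?thesis by (simp add: N_minus_one_U mod_simps) (simp add: mult_U)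
qed

lemma proj_eq_iff: "proj x = proj y \<longleftrightarrow> [y = x] (mod N) \<or> [y = - x] (mod N)"
proof
  assume "proj x = proj y"
  then have "y mod N \<in> proj x" by (simp add: proj_eq)
  then show "[y = x] (mod N) \<or> [y = - x] (mod N)" by (auto simp: proj_eq cong_def)
next
  assume "[y = x] (mod N) \<or> [y = - x] (mod N)"
  then show "proj x = proj y"
  proof
    assume "[y = x] (mod N)"
    moreover then have "[- y = - x] (mod N)" by (simp add: cong_minus_minus_iff)
    ultimately show ?thesis by (simp add: proj_eq cong_def)
  next
    assume "[y = - x] (mod N)"
    moreover then have "[- y = x] (mod N)" using cong_minus_minus_iff[of y "- x" N] by simp
    ultimately show ?thesis by (simp add: proj_eq cong_def insert_commute)
  qed
qed

section \<open>The quotient by the signs and its subgroup generated by 2\<close>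

abbreviation G :: "int set monoid" where "G \<equiv> G_grp (nat N)"
abbreviation H :: "int set set" where "H \<equiv> H_grp (nat N)"

lemma G_eq: "G = U Mod pm_one (nat N)"
  by (simp only: G_grp_def int_nat_N)

lemma group_G: "group G"
  unfolding G_eq by (rule normal.factorgroup_is_group[OF normal_pm_one])

lemma carrier_G: "carrier G = proj ` carrier U"
proof -
  have "carrier G = (\<lambda>x. pm_one (nat N) #>\<^bsub>U\<^esub> x) ` carrier U"
    unfolding G_eq FactGroup_def RCOSETS_def partial_object.simps by blast
  also have "\<dots> = proj ` carrier U"
    by (intro image_cong refl) (simp add: proj_def carrier_U)
  finally show ?thesis .
qed

lemma proj_in_G: "\<not> N dvd x \<Longrightarrow> proj x \<in> carrier G"
proof -
  assume "\<not> N dvd x"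
  then have "proj (x mod N) \<in> carrier G" unfolding carrier_G by (intro imageI mod_in_U)
  then show ?thesis by (simp add: proj_def)
qed

lemma proj_mult:
  assumes "\<not> N dvd x" "\<not> N dvd y"
  shows "proj x \<otimes>\<^bsub>G\<^esub> proj y = proj (x * y)"
proof -
  have "proj (x * y) = pm_one (nat N) #>\<^bsub>U\<^esub> (x mod N \<otimes>\<^bsub>U\<^esub> (y mod N))"
    by (simp add: proj_def mult_U mod_simps)
  also have "\<dots> = proj x \<otimes>\<^bsub>G\<^esub> proj y"
    using hom_mult[OF normal.r_coset_hom_Mod[OF normal_pm_one] mod_in_U[OF assms(1)] mod_in_U[OF assms(2)]]
    by (simp add: G_eq proj_def)
  finally show ?thesis ..
qed

lemma not_dvd_pow2: "\<not> N dvd 2 ^ k"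
  using prime_dvd_power[OF prime] not_dvd_two by blast

lemma proj_pow: "proj 2 [^]\<^bsub>G\<^esub> k = proj (2 ^ k)" for k :: nat
proof (induction k)
  case 0
  have "\<one>\<^bsub>G\<^esub> = pm_one (nat N)" by (simp add: G_eq)
  also have "\<dots> = proj 1" using gt2 by (simp add: proj_eq pm_one_eq zmod_zminus1_eq_if)
  finally show ?case by simp
next
  case (Suc k)
  then show ?case using proj_mult[OF not_dvd_pow2[of k] not_dvd_two] by (simp add: mult.commute)
qed

lemma H_eq: "H = range (\<lambda>i::int. proj 2 [^]\<^bsub>G\<^esub> i)"
proof -
  have "pm_one (nat N) #>\<^bsub>U\<^esub> two_res (nat N) = proj 2"
    using gt2 by (simp add: proj_def two_res_eq)
  then show ?thesis
    unfolding H_grp_def int_nat_N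
    using group.carrier_subgroup_generated_by_singleton[OF group_G proj_in_G[OF not_dvd_two]] by simp
qed

lemma subgroup_H: "subgroup H G"
  unfolding H_grp_def by (rule group.subgroup_subgroup_generated[OF group_G])

text \<open>The sign in \<open>pm_pow2\<close> is absorbed by the quotient and the power of 2 by
  \<open>H\<close>, so the classes of \<open>pm_pow2\<close> on units are the cosets counted by the
  index.\<close>

lemma rcos_H_eq_iff:
  assumes x: "\<not> N dvd x" and y: "\<not> N dvd y"
  shows "H #>\<^bsub>G\<^esub> proj x = H #>\<^bsub>G\<^esub> proj y \<longleftrightarrow> pm_pow2 x y"
proof
  interpret G: group G by (rule group_G)
  have pow_mult: "proj 2 [^]\<^bsub>G\<^esub> k \<otimes>\<^bsub>G\<^esub> proj z = proj (2 ^ k * z)" if "\<not> N dvd z" for k :: nat and z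
    using that by (simp add: proj_pow proj_mult not_dvd_pow2)
  {
    assume "pm_pow2 x y"
    then obtain k where "[y = 2 ^ k * x] (mod N) \<or> [y = - (2 ^ k * x)] (mod N)"
      unfolding pm_pow2_def by blast
    then have "proj y = proj 2 [^]\<^bsub>G\<^esub> k \<otimes>\<^bsub>G\<^esub> proj x"
      using pow_mult[OF x] proj_eq_iff[of "2 ^ k * x" y] by simp
    moreover have "proj 2 [^]\<^bsub>G\<^esub> k \<in> H"
      unfolding H_eq by (metis int_pow_int rangeI)
    ultimately have "proj y \<in> H #>\<^bsub>G\<^esub> proj x"
      unfolding r_coset_def by blast
    then show "H #>\<^bsub>G\<^esub> proj x = H #>\<^bsub>G\<^esub> proj y"
      using G.repr_independence proj_in_G[OF x] subgroup_H by blast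
  }
  assume "H #>\<^bsub>G\<^esub> proj x = H #>\<^bsub>G\<^esub> proj y"
  then have "proj y \<in> H #>\<^bsub>G\<^esub> proj x"
    using G.rcos_self[OF proj_in_G[OF y] subgroup_H] by simp
  then obtain i :: int where i: "proj y = proj 2 [^]\<^bsub>G\<^esub> i \<otimes>\<^bsub>G\<^esub> proj x"
    unfolding H_eq r_coset_def by blast
  show "pm_pow2 x y"
  proof (cases "i \<ge> 0")
    case True
    then obtain k where "i = int k" using nonneg_int_cases by blast
    with i have "proj y = proj (2 ^ k * x)" using pow_mult[OF x] by (simp add: int_pow_int)
    then have "proj (2 ^ k * x) = proj y" ..
    then show ?thesis unfolding proj_eq_iff pm_pow2_def by blast
  next
    \<comment> \<open>A negative power is moved to the other side, which gives the relation from
      \<open>y\<close> to \<open>x\<close>; symmetry finishes.\<close>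
    case False
    then obtain k where k: "i = - int k" using nonpos_int_cases[of i] by auto
    note mem = proj_in_G[OF not_dvd_two] proj_in_G[OF x] proj_in_G[OF y]
    have "proj 2 [^]\<^bsub>G\<^esub> k \<otimes>\<^bsub>G\<^esub> proj y = proj x"
      using i mem by (simp add: k G.int_pow_neg int_pow_int G.m_assoc[symmetric] G.r_inv)
    then have "proj (2 ^ k * y) = proj x" using pow_mult[OF y] by simp
    then have "pm_pow2 y x" unfolding proj_eq_iff pm_pow2_def by blast
    then show ?thesis by (rule pm_pow2_sym)
  qed
qed

lemma group_index_eq: "group_index G H = card class_reps"
proof -
  have unit: "\<not> N dvd d" if "d \<in> class_reps" for d
    using that half_range(1) by (auto simp: class_reps_def)
  have "bij_betw (\<lambda>d. H #>\<^bsub>G\<^esub> proj d) class_reps (rcosets\<^bsub>G\<^esub> H)"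
    unfolding bij_betw_def
  proof
    show "inj_on (\<lambda>d. H #>\<^bsub>G\<^esub> proj d) class_reps"
      by (intro inj_onI class_reps_unique) (simp_all add: rcos_H_eq_iff unit)
    show "(\<lambda>d. H #>\<^bsub>G\<^esub> proj d) ` class_reps = rcosets\<^bsub>G\<^esub> H"
    proof (intro equalityI subsetI)
      fix X assume "X \<in> (\<lambda>d. H #>\<^bsub>G\<^esub> proj d) ` class_reps"
      then show "X \<in> rcosets\<^bsub>G\<^esub> H"
        using proj_in_G unit by (auto simp: RCOSETS_def)
    next
      fix X assume "X \<in> rcosets\<^bsub>G\<^esub> H"
      then obtain x where x: "x \<in> carrier U" "X = H #>\<^bsub>G\<^esub> proj x"
        by (auto simp: RCOSETS_def carrier_G)
      obtain d where "d \<in> class_reps" "pm_pow2 d x"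
        using class_rep_exists U_not_dvd[OF x(1)] by blast
      then show "X \<in> (\<lambda>d. H #>\<^bsub>G\<^esub> proj d) ` class_reps"
        using x rcos_H_eq_iff[OF unit U_not_dvd[OF x(1)]] by blast
    qed
  qed
  then show ?thesis unfolding group_index_def by (simp add: bij_betw_same_card)
qed

lemma card_class_reps_eq_1_iff: "card class_reps = 1 \<longleftrightarrow> (\<forall>x\<in>carrier U. pm_pow2 1 x)"
proof
  assume "card class_reps = 1"
  then have reps: "class_reps = {1}" using one_class_rep by (metis card_1_singletonE singletonD)
  show "\<forall>x\<in>carrier U. pm_pow2 1 x"
  proof
    fix x assume "x \<in> carrier U"
    then obtain d where "d \<in> class_reps" "pm_pow2 d x"
      by (rule class_rep_exists[OF U_not_dvd])
    with reps show "pm_pow2 1 x" by simp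
  qed
next
  assume all: "\<forall>x\<in>carrier U. pm_pow2 1 x"
  have "d = 1" if "d \<in> class_reps" for d
  proof -
    have "d \<in> carrier U" using that half_range(3) by (auto simp: class_reps_def carrier_U)
    with all have "pm_pow2 1 d" by blast
    then show ?thesis using class_reps_unique[OF one_class_rep that] by blast
  qed
  then have "class_reps = {1}" using one_class_rep by blast
  then show "card class_reps = 1" by simp
qed

lemma pm_pow2_mult: "pm_pow2 a b \<Longrightarrow> pm_pow2 (a * c) (b * c)"
proof -
  assume "pm_pow2 a b"
  then obtain k where "[b = 2 ^ k * a] (mod N) \<or> [b = - (2 ^ k * a)] (mod N)"
    unfolding pm_pow2_def by blast
  then have "[b * c = 2 ^ k * a * c] (mod N) \<or> [b * c = - (2 ^ k * a) * c] (mod N)"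
    by (meson cong_scalar_right)
  then show ?thesis unfolding pm_pow2_def by (auto simp: mult.assoc)
qed

text \<open>The generated subgroup is the class \<open>A\<close> of 1: \<open>A\<close> is a
  subgroup containing the generators, and conversely each of its elements is a power of 2 up to
  sign, hence a product of generators.\<close>

lemma generated_eq_iff:
  "carrier (subgroup_generated U (insert (two_res (nat N)) (pm_one (nat N)))) = carrier U \<longleftrightarrow>
   (\<forall>x\<in>carrier U. pm_pow2 1 x)"
  (is "?K = _ \<longleftrightarrow> _")
proof -
  interpret U: group U by (rule group_U)
  define A where "A = {x \<in> carrier U. pm_pow2 1 x}"
  have gens: "insert (two_res (nat N)) (pm_one (nat N)) = {2, 1, N - 1}"
    by (simp add: two_res_eq pm_one_eq)
  have gens_U: "{2, 1, N - 1} \<subseteq> carrier U" using gt2 by (auto simp: carrier_U)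
  have "subgroup A U"
  proof (rule U.subgroupI)
    have "1 \<in> A" using gt2 by (simp add: A_def carrier_U pm_pow2_refl)
    then show "A \<noteq> {}" by blast
  next
    fix a assume a: "a \<in> A"
    then have aU: "a \<in> carrier U" by (simp add: A_def)
    have "pm_pow2 (inv\<^bsub>U\<^esub> a) (a * inv\<^bsub>U\<^esub> a)"
      using pm_pow2_mult[of 1 a "inv\<^bsub>U\<^esub> a"] a by (simp add: A_def)
    moreover have "[a * inv\<^bsub>U\<^esub> a = 1] (mod N)"
      using cong_mult_U[of a "inv\<^bsub>U\<^esub> a"] U.r_inv[OF aU] by (simp add: one_U cong_sym)
    ultimately have "pm_pow2 1 (inv\<^bsub>U\<^esub> a)" using pm_pow2_refl pm_pow2_trans pm_pow2_sym by blast
    then show "inv\<^bsub>U\<^esub> a \<in> A" using aU by (simp add: A_def)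
  next
    fix a b assume ab: "a \<in> A" "b \<in> A"
    then have "pm_pow2 1 (a * b)" using pm_pow2_mult[of 1 a b] pm_pow2_trans[of 1 b "a * b"] by (simp add: A_def)
    then have "pm_pow2 1 (a \<otimes>\<^bsub>U\<^esub> b)" using pm_pow2_trans pm_pow2_refl cong_sym[OF cong_mult_U] by blast
    then show "a \<otimes>\<^bsub>U\<^esub> b \<in> A" using ab by (simp add: A_def)
  qed (auto simp: A_def)
  moreover have "{2, 1, N - 1} \<subseteq> A"
  proof -
    have "pm_pow2 1 2" using pm_pow2_double[of 1] by simp
    moreover have "pm_pow2 1 1" by (intro pm_pow2_refl) simp
    moreover have "pm_pow2 1 (N - 1)" by (rule pm_pow2_minus) (simp add: cong_iff_dvd_diff)
    ultimately show ?thesis using gens_U by (auto simp: A_def)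
  qed
  ultimately have "?K \<subseteq> A" unfolding gens by (rule U.subgroup_generated_minimal)
  moreover have "A \<subseteq> ?K"
  proof
    have K: "subgroup ?K U" by (rule U.subgroup_subgroup_generated)
    have gens_K: "{2, 1, N - 1} \<subseteq> ?K"
      unfolding gens by (rule U.subgroup_generated_subset_carrier_subset[OF gens_U])
    have pow: "2 ^ k mod N \<in> ?K" for k
    proof (induction k)
      case 0
      then show ?case using gens_K gt2 by simp
    next
      case (Suc k)
      have "2 \<otimes>\<^bsub>U\<^esub> (2 ^ k mod N) \<in> ?K" using gens_K Suc by (intro subgroup.m_closed[OF K]) auto
      then show ?case by (simp add: mult_U mod_simps)
    qed
    fix x assume "x \<in> A"
    then obtain k where x: "x \<in> {1..<N}" and k: "[x = 2 ^ k] (mod N) \<or> [x = - (2 ^ k)] (mod N)"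
      by (auto simp: A_def pm_pow2_def carrier_U)
    have "(N - 1) \<otimes>\<^bsub>U\<^esub> (2 ^ k mod N) \<in> ?K"
      using gens_K pow by (intro subgroup.m_closed[OF K]) auto
    then have "(- (2 ^ k)) mod N \<in> ?K" by (simp add: N_minus_one_U mod_simps)
    then show "x \<in> ?K" using k pow x by (auto simp: cong_def)
  qed
  ultimately have "?K = A" by blast
  then show ?thesis by (auto simp: A_def)
qed

end

section \<open>Faces and the rank formula\<close>

context odd_prime_modulus
begin

definition ap_face :: "int \<Rightarrow> int \<Rightarrow> int set" where
  "ap_face d m = {(m - d) mod N, m mod N, (m + d) mod N}"

lemma ap_face_distinct:
  assumes "\<not> N dvd d"
  shows "(m - d) mod N \<noteq> m mod N" "m mod N \<noteq> (m + d) mod N" "(m - d) mod N \<noteq> (m + d) mod N"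
  using assms not_dvd_mult[OF not_dvd_two assms] by (simp_all add: mod_eq_dvd_iff)

lemma card_ap_face: "\<not> N dvd d \<Longrightarrow> card (ap_face d m) = 3"
  using ap_face_distinct by (simp add: ap_face_def)

lemma ap_face_minus: "ap_face (N - d) m = ap_face d m"
proof -
  have "(m - (N - d)) mod N = (m + d) mod N" "(m + (N - d)) mod N = (m - d) mod N"
    by (simp_all add: mod_eq_dvd_iff)
  then show ?thesis by (simp add: ap_face_def insert_commute)
qed

lemma mem_ap_triples_iff:
  "s \<in> ap_triples (nat N) \<longleftrightarrow>
   (\<exists>a d. s = {a, (a + d) mod N, ((a + d) mod N + d) mod N} \<and> a \<in> {0..<N} \<and> d \<in> {2..<N - 1})"
proof -
  have "carrier (residue_ring N) = {0..<N}" by (rule carrier_Zmod)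
  moreover have "d \<in> {0..<N} \<and> d \<notin> {0, 1, N - 1} \<longleftrightarrow> d \<in> {2..<N - 1}" for d
    using gt2 by auto
  moreover have "\<one>\<^bsub>residue_ring N\<^esub> = 1" "\<zero>\<^bsub>residue_ring N\<^esub> = 0"
    "x \<oplus>\<^bsub>residue_ring N\<^esub> y = (x + y) mod N" for x y
    by (simp_all add: residue_ring_def)
  ultimately show ?thesis
    unfolding ap_triples_def int_nat_N Zmod_minus_one mem_Collect_eq by simp
qed

lemma two_faces_eq: "two_faces (ap_complex (nat N)) = (\<lambda>(d, m). ap_face d m) ` face_index"
proof (intro equalityI subsetI)
  fix s assume "s \<in> two_faces (ap_complex (nat N))"
  then have "s \<in> ap_triples (nat N)" by (auto simp: two_faces_def ap_complex_def)
  then obtain a d where s: "s = {a, (a + d) mod N, ((a + d) mod N + d) mod N}"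
    and a: "a \<in> {0..<N}" and d: "d \<in> {2..<N - 1}"
    unfolding mem_ap_triples_iff by blast
  define m where "m = (a + d) mod N"
  have "(m - d) mod N = a" using a by (simp add: m_def mod_simps)
  then have face: "s = ap_face d m" by (simp add: s ap_face_def m_def)
  have m: "m \<in> {0..<N}" using gt2 by (simp add: m_def)
  show "s \<in> (\<lambda>(d, m). ap_face d m) ` face_index"
  proof (cases "d < half")
    case True
    then have "(d, m) \<in> face_index" using d m by (simp add: face_index_def)
    then show ?thesis using face by blast
  next
    \<comment> \<open>A difference in the upper half is replaced by its negative; from
      \<open>half <= d <= N - 2\<close> follows \<open>2 <= N - d < half\<close>.\<close>
    case False
    then have "(N - d, m) \<in> face_index" using d m two_half by (simp add: face_index_def)
    moreover have "s = ap_face (N - d) m" by (simp add: face ap_face_minus)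
    ultimately show ?thesis by blast
  qed
next
  fix s assume "s \<in> (\<lambda>(d, m). ap_face d m) ` face_index"
  then obtain d m where s: "s = ap_face d m" and d: "d \<in> {2..<half}" and m: "m \<in> {0..<N}"
    by (auto simp: face_index_def)
  have "s = {(m - d) mod N, ((m - d) mod N + d) mod N, (((m - d) mod N + d) mod N + d) mod N}"
    by (simp add: s ap_face_def mod_simps)
  moreover have "(m - d) mod N \<in> {0..<N}" "d \<in> {2..<N - 1}" using gt2 d two_half by auto
  ultimately have "s \<in> ap_triples (nat N)" unfolding mem_ap_triples_iff by blast
  moreover have "card s = 3" using half_range(1)[of d] d by (simp add: s card_ap_face)
  ultimately show "s \<in> two_faces (ap_complex (nat N))"
    by (simp add: two_faces_def ap_complex_def)
qed

lemma eq_of_dvd_diff: "x \<in> {0..<N} \<Longrightarrow> y \<in> {0..<N} \<Longrightarrow> N dvd x - y \<Longrightarrow> x = y"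
  by (metis atLeastLessThan_iff mod_eq_dvd_iff mod_pos_pos_trivial)

text \<open>The vertex sum of a face is \<open>3 * m\<close>, which determines its centre \<open>m\<close> as \<open>N > 3\<close>.\<close>

lemma inj_on_ap_face: "inj_on (\<lambda>(d, m). ap_face d m) face_index"
proof (rule inj_onI)
  fix i i' assume ii: "i \<in> face_index" "i' \<in> face_index"
    "(case i of (d, m) \<Rightarrow> ap_face d m) = (case i' of (d, m) \<Rightarrow> ap_face d m)"
  obtain d m d' m' where i: "i = (d, m)" "i' = (d', m')" by fastforce
  have d: "d \<in> {2..<half}" "d' \<in> {2..<half}" and m: "m \<in> {0..<N}" "m' \<in> {0..<N}"
    and eq: "ap_face d m = ap_face d' m'"
    using ii by (auto simp: i face_index_def)
  have unit: "\<not> N dvd d" "\<not> N dvd d'" using d half_range(1) by auto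
  have sum: "[\<Sum>(ap_face d m) = 3 * m] (mod N)" if "\<not> N dvd d" for d m
  proof -
    have "\<Sum>(ap_face d m) = (m - d) mod N + (m mod N + (m + d) mod N)"
      using ap_face_distinct[OF that, of m] by (simp add: ap_face_def)
    also have "[\<dots> = (m - d) + (m + (m + d))] (mod N)"
      by (intro cong_add) (simp_all add: cong_def)
    finally show ?thesis by simp
  qed
  have "[3 * m = 3 * m'] (mod N)"
    using cong_trans[OF cong_sym[OF sum[OF unit(1), of m]]] sum[OF unit(2), of m'] eq by simp
  then have "N dvd 3 * (m - m')" by (simp add: cong_iff_dvd_diff algebra_simps)
  \<comment> \<open>A nonempty range of \<open>d\<close> forces \<open>half >= 3\<close>, that is
    \<open>N >= 5\<close>.\<close>
  moreover have "\<not> N dvd 3" using d(1) two_half zdvd_imp_le[of N 3] by auto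
  ultimately have "N dvd m - m'" using prime prime_dvd_mult_iff by blast
  then have mm: "m = m'" using m eq_of_dvd_diff by blast
  have "(m + d) mod N \<in> ap_face d' m" using eq mm by (auto simp: ap_face_def)
  \<comment> \<open>With a common centre, \<open>m + d\<close> must be one of \<open>m - d'\<close>,
    \<open>m\<close> and \<open>m + d'\<close>. The first is ruled out because
    \<open>d + d' < N\<close>.\<close>
  then have "N dvd d + d' \<or> N dvd d \<or> N dvd d - d'"
    by (auto simp: ap_face_def mod_eq_dvd_iff)
  moreover have "\<not> N dvd d + d'"
    using d two_half zdvd_imp_le[of N "d + d'"] by auto
  ultimately have "N dvd d - d'" using unit by blast
  then have "d = d'" using d half_range(3) eq_of_dvd_diff[of d d'] by auto
  then show "i = i'" using mm i by simp
qed

lemma card_two_faces: "card (two_faces (ap_complex (nat N))) = card face_index"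
  unfolding two_faces_eq by (rule card_image[OF inj_on_ap_face])

end

section \<open>Independence of the chosen orientations\<close>

context ap_boundary
begin

lemma edge_chain_swap:
  assumes "x \<in> {0..<N}" "y \<in> {0..<N}" "x \<noteq> y"
  shows "edge_chain oE (y, x) = - edge_chain oE (x, y)"
proof
  have "\<not> [x = y] (mod N)" using assms by (simp add: cong_def)
  from edge_swap[OF this] show "edge_chain oE (y, x) e = (- edge_chain oE (x, y)) e" for e
    using assms by (simp add: edge_def)
qed

text \<open>The boundary is alternating in the vertices of a triangle, as reversing an edge negates
  its chain.\<close>

lemma boundary_permute:
  assumes xyz: "x \<in> {0..<N}" "y \<in> {0..<N}" "z \<in> {0..<N}" and distinct: "x \<noteq> y" "y \<noteq> z" "x \<noteq> z"
    and eq: "{u, v, w} = {x, y, z}"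
  shows "boundary oE (u, v, w) \<in> {boundary oE (x, y, z), - boundary oE (x, y, z)}"
proof -
  note swap = edge_chain_swap[OF xyz(1,2) distinct(1)] edge_chain_swap[OF xyz(2,3) distinct(2)]
    edge_chain_swap[OF xyz(1,3) distinct(3)]
  have "u \<in> {x, y, z}" "v \<in> {x, y, z}" "w \<in> {x, y, z}" "x \<in> {u, v, w}" "y \<in> {u, v, w}" "z \<in> {u, v, w}"
    using eq by blast+
  then consider "u = x" "v = y" "w = z" | "u = x" "v = z" "w = y" | "u = y" "v = x" "w = z"
    | "u = y" "v = z" "w = x" | "u = z" "v = x" "w = y" | "u = z" "v = y" "w = x"
    using distinct by auto
  then show ?thesis by cases (simp_all add: swap)
qed

lemma boundary_column_ap_face:
  assumes oT: "triangle_orientation {0..<N} oT" and d: "\<not> N dvd d"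
  shows "boundary_column oE oT (ap_face d m) \<in> {ap_bd d m, - ap_bd d m}"
proof -
  obtain u v w where uvw: "oT (ap_face d m) = (u, v, w)" by (metis prod_cases3)
  have mem: "(m - d) mod N \<in> {0..<N}" "m mod N \<in> {0..<N}" "(m + d) mod N \<in> {0..<N}"
    using gt2 by auto
  then have "ap_face d m \<subseteq> {0..<N}" unfolding ap_face_def by blast
  then have "ap_face d m = {u, v, w}"
    using oT[unfolded triangle_orientation_def, rule_format, of "ap_face d m"] uvw card_ap_face[OF d]
    by simp
  then have "{u, v, w} = {(m - d) mod N, m mod N, (m + d) mod N}" by (simp add: ap_face_def)
  from boundary_permute[OF mem ap_face_distinct[OF d] this]
  show ?thesis unfolding boundary_column_def uvw ap_bd_def .
qed

text \<open>The columns agree up to sign with the boundaries of the progressions in their natural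
  order, and signs do not affect the span.\<close>

lemma rank_ap_complex:
  assumes "triangle_orientation {0..<N} oT"
  shows "rank_rat oE oT (two_faces (ap_complex (nat N))) = card face_basis"
proof -
  define B where "B = (\<lambda>(d, m). boundary_column oE oT (ap_face d m))"
  define D where "D = (\<lambda>(d, m). ap_bd d m)"
  have BD: "B i = D i \<or> B i = - D i" if "i \<in> face_index" for i
  proof -
    obtain d m where i: "i = (d, m)" by fastforce
    have "\<not> N dvd d" using that half_range(1)[of d] by (simp add: i face_index_def)
    from boundary_column_ap_face[OF assms this, of m] show ?thesis by (simp add: i B_def D_def)
  qed
  have "rat_fun.span (B ` face_index) = rat_fun.span (D ` face_index)"
  proof (rule rat_fun.span_eq[THEN iffD2], intro conjI image_subsetI)
    fix i assume i: "i \<in> face_index"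
    have "D i \<in> rat_fun.span (D ` face_index)" "B i \<in> rat_fun.span (B ` face_index)"
      using i by (auto intro: rat_fun.span_base)
    moreover from this have "- D i \<in> rat_fun.span (D ` face_index)" "- B i \<in> rat_fun.span (B ` face_index)"
      by (auto intro: rat_fun.span_neg)
    ultimately show "B i \<in> rat_fun.span (D ` face_index)" "D i \<in> rat_fun.span (B ` face_index)"
      using BD[OF i] by (metis minus_minus)+
  qed
  then have "rat_fun.dim (B ` face_index) = rat_fun.dim (D ` face_index)"
    by (metis rat_fun.dim_span)
  also have "\<dots> = card face_basis" unfolding D_def by (rule rank_ap_bd)
  also have "B ` face_index = boundary_column oE oT ` two_faces (ap_complex (nat N))"
    unfolding two_faces_eq image_image B_def by (simp add: case_prod_unfold)
  finally show ?thesis by (simp add: rank_rat_def)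
qed

end

section \<open>The even prime\<close>

lemma two_faces_ap_complex_2: "two_faces (ap_complex 2) = {}"
proof -
  have "ap_triples 2 = {}"
    by (auto simp: ap_triples_def residue_ring_def)
  then show ?thesis by (auto simp: two_faces_def ap_complex_def)
qed

lemma residues_2: "residues (int 2)"
  by unfold_locales simp

lemma carrier_Zmod_units_2: "carrier (Zmod_units 2) = {1}"
proof -
  have "{x :: int. 0 < x \<and> x < 2 \<and> coprime x 2} = {1}" by auto
  then show ?thesis using residues.res_units_eq[OF residues_2] by (simp add: units_of_carrier)
qed

lemma group_index_2: "group_index (G_grp 2) (H_grp 2) = 1"
proof -
  have "carrier (G_grp 2) = {pm_one 2 #>\<^bsub>Zmod_units 2\<^esub> 1}"
    unfolding G_grp_def FactGroup_def RCOSETS_def partial_object.simps carrier_Zmod_units_2 by simp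
  then show ?thesis by (simp add: group_index_def RCOSETS_def)
qed

lemma generated_2: "carrier (subgroup_generated (Zmod_units 2) S) = carrier (Zmod_units 2)"
proof -
  have "group (Zmod_units 2)"
    using comm_monoid.units_comm_group[OF residues.comm_monoid[OF residues_2]]
    by (rule comm_group.axioms)
  then have "carrier (subgroup_generated (Zmod_units 2) S) \<subseteq> {1}"
    unfolding carrier_Zmod_units_2[symmetric] by (rule group.carrier_subgroup_generated_subset)
  moreover have "\<one>\<^bsub>Zmod_units 2\<^esub> \<in> carrier (subgroup_generated (Zmod_units 2) S)"
    unfolding carrier_subgroup_generated by (rule generate.one)
  ultimately show ?thesis unfolding carrier_Zmod_units_2 by (auto dest: subset_singletonD)
qed

theorem theorem2:
  fixes n :: nat
    and oE :: "int set \<Rightarrow> int \<times> int"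
    and oT :: "int set \<Rightarrow> int \<times> int \<times> int"
  assumes "prime n"
    and "edge_orientation (carrier (Zmod n)) oE"
    and "triangle_orientation (carrier (Zmod n)) oT"
  shows "int (rank_rat oE oT (two_faces (ap_complex n))) =
           int (card (two_faces (ap_complex n)))
             - (int n - 1) * (int (group_index (G_grp n) (H_grp n)) - 1)
         \<and> (acyclic_rat oE oT (two_faces (ap_complex n)) \<longleftrightarrow>
              carrier (subgroup_generated (Zmod_units n) (insert (two_res n) (pm_one n)))
                = carrier (Zmod_units n))"
proof (cases "n = 2")
  \<comment> \<open>There are no faces, the index is 1, and the trivial unit group is generated by
    any set, so the formula reads \<open>0 = 0\<close> and both sides of the equivalence
    hold.\<close>
  case True
  then show ?thesis
    unfolding acyclic_rat_def
    by (simp only: two_faces_ap_complex_2 group_index_2 generated_2 rank_rat_def image_empty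
        rat_fun.dim_eq_card_independent[OF rat_fun.independent_empty] card.empty) simp
next
  case False
  have "n > 2" using prime_ge_2_nat[OF assms(1)] False by linarith
  then have "odd (int n)" using prime_odd_nat[OF assms(1)] by simp
  moreover have "prime (int n)" using assms(1) by simp
  ultimately interpret odd_prime_modulus "int n" by unfold_locales
  have "edge_orientation {0..<int n} oE" using assms(2) unfolding carrier_Zmod .
  then interpret ap_boundary "int n" oE by unfold_locales
  have rank: "rank_rat oE oT (two_faces (ap_complex n)) = card face_basis"
    using rank_ap_complex[of oT] assms(3) by (simp only: carrier_Zmod nat_int)
  have faces: "card (two_faces (ap_complex n)) = card face_index"
    using card_two_faces by (simp only: nat_int)
  have index: "group_index (G_grp n) (H_grp n) = card class_reps"
    using group_index_eq by (simp only: nat_int)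
  have "carrier (subgroup_generated (Zmod_units n) (insert (two_res n) (pm_one n))) = carrier (Zmod_units n)
      \<longleftrightarrow> card class_reps = 1"
    using generated_eq_iff card_class_reps_eq_1_iff by (simp only: nat_int)
  \<comment> \<open>As \<open>n - 1\<close> is positive, the correction term vanishes exactly when
    there is a single class.\<close>
  moreover have "card face_basis = card face_index \<longleftrightarrow> card class_reps = 1"
    using card_face_basis gt2 by auto
  ultimately show ?thesis
    unfolding acyclic_rat_def rank faces index using card_face_basis by simp
qed

end
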